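(* Let $M_1,M_2$ be matroids of positive rank on disjoint ground sets $S_1,S_2$, with $S'_1\subseteq S_1$, $S'_2\subseteq S_2$, and let $k$ be an integer with $k\ge r(M_1)+\eta_{M_1}(S'_1)+r(M_2)+\eta_{M_2}(S'_2)$. Let $T_1,T_2$ be sets with $|T_1|=k-r(M_1)-|S'_2|$, $|T_2|=k-r(M_2)-|S'_1|$ such that $T_1,T_2,S_1\cup S_2$ are pairwise disjoint. Suppose neither $M_1$ nor $M_2$ is uniform, $\mathcal{Z}'(M_1)\ne\{S'_1\}$ and $\mathcal{Z}'(M_2)\ne\{S'_2\}$. Then $M=M_k(M_1,S'_1,T_1;M_2,S'_2,T_2)$ is a labelled intertwine of $M_1$ and $M_2$.
   Context: All matroids are finite. A cyclic flat is a flat that is a (possibly empty) union of circuits; for a matroid $N$, $\mathcal{Z}'(N)$ denotes its set of nonempty proper cyclic flats, and $\eta_N(Y)=|Y|-r_N(Y)$ is the nullity. A matroid $M$ is a labelled intertwine of $N_1$ and $N_2$ if $M$ has minors equal to $N_1$ and to $N_2$ (equality, not merely isomorphism), but no proper minor of $M$ has minors equal to both. Construction $M_k(N_1,A_1,U_1;N_2,A_2,U_2)$: let $N_1,N_2$ be matroids of positive rank on disjoint ground sets $R_1,R_2$ with rank functions $\rho_1,\rho_2$; let $A_1\subseteq R_1$, $A_2\subseteq R_2$; let $k$ be an integer with $k\ge r(N_1)+\eta_{N_1}(A_1)+r(N_2)+\eta_{N_2}(A_2)$; and let $U_1,U_2$ be sets with $|U_1|=k-r(N_1)-|A_2|$,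 $|U_2|=k-r(N_2)-|A_1|$, such that $U_1,U_2,R_1\cup R_2$ are pairwise disjoint. Let $E=R_1\cup R_2\cup U_1\cup U_2$. Then $M_k(N_1,A_1,U_1;N_2,A_2,U_2)$ is the (existing and unique) matroid on $E$ whose cyclic flats are exactly: $\emptyset$, of rank $0$; $E$, of rank $k$; the sets $F\cup U_1\cup A_2$ for $F\in\mathcal{Z}'(N_1)$, of rank $\rho_1(F)+|U_1|+|A_2|$; and the sets $F\cup U_2\cup A_1$ for $F\in\mathcal{Z}'(N_2)$, of rank $\rho_2(F)+|U_2|+|A_1|$. *)

theory Defs
  imports Main
begin

record 'a indep_system =
  ground :: "'a set"
  indeps :: "'a set set"

locale matroid =
  fixes M :: "'a indep_system"
  assumes finite_ground: "finite (ground M)"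
    and indeps_subset: "I \<in> indeps M \<Longrightarrow> I \<subseteq> ground M"
    and indeps_empty: "{} \<in> indeps M"
    and indeps_hereditary: "I \<in> indeps M \<Longrightarrow> J \<subseteq> I \<Longrightarrow> J \<in> indeps M"
    and indeps_augment: "I \<in> indeps M \<Longrightarrow> J \<in> indeps M \<Longrightarrow> card I < card J \<Longrightarrow>
      \<exists>x \<in> J - I. insert x I \<in> indeps M"

definition rank :: "'a indep_system \<Rightarrow> 'a set \<Rightarrow> nat" where
  "rank M X = Max (card ` {I \<in> indeps M. I \<subseteq> X})"

text \<open>For a finite set \<open>X\<close> the rank is at most \<open>card X\<close>, so this subtraction never truncates.\<close>

definition nullity :: "'a indep_system \<Rightarrow> 'a set \<Rightarrow> nat" where
  "nullity M X = card X - rank M X"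

definition circuit :: "'a indep_system \<Rightarrow> 'a set \<Rightarrow> bool" where
  "circuit M C \<longleftrightarrow> C \<subseteq> ground M \<and> C \<notin> indeps M \<and> (\<forall>X. X \<subset> C \<longrightarrow> X \<in> indeps M)"

definition flat :: "'a indep_system \<Rightarrow> 'a set \<Rightarrow> bool" where
  "flat M F \<longleftrightarrow> F \<subseteq> ground M \<and> (\<forall>x \<in> ground M - F. rank M F < rank M (insert x F))"

definition cyclic_flat :: "'a indep_system \<Rightarrow> 'a set \<Rightarrow> bool" where
  "cyclic_flat M F \<longleftrightarrow> flat M F \<and> (\<exists>\<C>. (\<forall>C \<in> \<C>. circuit M C) \<and> F = \<Union>\<C>)"

definition proper_cyclic_flats :: "'a indep_system \<Rightarrow> 'a set set" where
  "proper_cyclic_flats M = {F. cyclic_flat M F \<and> F \<noteq> {} \<and> F \<noteq> ground M}"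

definition uniform :: "'a indep_system \<Rightarrow> bool" where
  "uniform M \<longleftrightarrow> (\<exists>r. indeps M = {X. X \<subseteq> ground M \<and> card X \<le> r})"

definition delete :: "'a indep_system \<Rightarrow> 'a set \<Rightarrow> 'a indep_system" where
  "delete M D = \<lparr>ground = ground M - D, indeps = {X \<in> indeps M. X \<subseteq> ground M - D}\<rparr>"

text \<open>The rank of \<open>X\<close> in the contraction is \<open>rank M (X \<union> C) - rank M C\<close>; the independent sets
  are those for which this equals \<open>card X\<close>.\<close>

definition contract :: "'a indep_system \<Rightarrow> 'a set \<Rightarrow> 'a indep_system" where
  "contract M C = \<lparr>ground = ground M - C,
     indeps = {X. X \<subseteq> ground M - C \<and> rank M (X \<union> C) = rank M C + card X}\<rparr>"

definition minor_of :: "'a indep_system \<Rightarrow> 'a indep_system \<Rightarrow> bool" where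
  "minor_of N M \<longleftrightarrow> (\<exists>C D. C \<subseteq> ground M \<and> D \<subseteq> ground M \<and> C \<inter> D = {} \<and>
     N = delete (contract M C) D)"

definition labelled_intertwine ::
  "'a indep_system \<Rightarrow> 'a indep_system \<Rightarrow> 'a indep_system \<Rightarrow> bool" where
  "labelled_intertwine M N\<^sub>1 N\<^sub>2 \<longleftrightarrow> matroid M \<and> minor_of N\<^sub>1 M \<and> minor_of N\<^sub>2 M \<and>
     \<not> (\<exists>N. minor_of N M \<and> N \<noteq> M \<and> minor_of N\<^sub>1 N \<and> minor_of N\<^sub>2 N)"

text \<open>The matroid \<open>M\<^sub>k(N\<^sub>1,A\<^sub>1,U\<^sub>1;N\<^sub>2,A\<^sub>2,U\<^sub>2)\<close>, specified by its cyclic flats paired with their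
  ranks. It is meaningful only where such a matroid exists and is unique. Existence does not
  follow from the bounds on \<open>k\<close> and the sizes of \<open>U\<^sub>1\<close>, \<open>U\<^sub>2\<close> alone: if \<open>N\<^sub>1\<close>, \<open>N\<^sub>2\<close> are free, \<open>A\<^sub>i\<close>
  is the ground set of \<open>N\<^sub>i\<close> and \<open>k\<close> is minimal, then the ground set would be a cyclic flat
  of rank equal to its size. It does hold when neither \<open>N\<^sub>1\<close> nor \<open>N\<^sub>2\<close> is uniform.\<close>

definition M_k :: "nat \<Rightarrow> 'a indep_system \<Rightarrow> 'a set \<Rightarrow> 'a set \<Rightarrow>
    'a indep_system \<Rightarrow> 'a set \<Rightarrow> 'a set \<Rightarrow> 'a indep_system" where
  "M_k k N\<^sub>1 A\<^sub>1 U\<^sub>1 N\<^sub>2 A\<^sub>2 U\<^sub>2 =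
    (let E = ground N\<^sub>1 \<union> ground N\<^sub>2 \<union> U\<^sub>1 \<union> U\<^sub>2 in
     THE M. matroid M \<and> ground M = E \<and>
       {(Y, rank M Y) | Y. cyclic_flat M Y} =
         {({}, 0), (E, k)}
         \<union> {(F \<union> U\<^sub>1 \<union> A\<^sub>2, rank N\<^sub>1 F + card U\<^sub>1 + card A\<^sub>2) | F. F \<in> proper_cyclic_flats N\<^sub>1}
         \<union> {(F \<union> U\<^sub>2 \<union> A\<^sub>1, rank N\<^sub>2 F + card U\<^sub>2 + card A\<^sub>1) | F. F \<in> proper_cyclic_flats N\<^sub>2})"

end

theory Submission
  imports Defs
begin

text \<open>A matroid is determined by its cyclic flats and their ranks through
  \<open>rank X = min (rank Z + card (X - Z))\<close> over cyclic flats \<open>Z\<close>, and a family of ranked sets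
  arises in this way once rank and nullity are strictly monotone on it and every two members have
  an upper and a lower bound satisfying a submodular inequality. For the family defining
  \<open>M = M\<^sub>k(N\<^sub>1,A\<^sub>1,U\<^sub>1;N\<^sub>2,A\<^sub>2,U\<^sub>2)\<close> two lifted flats from different sides are bounded by the ground
  set and the empty set, and that inequality is what the lower bound on \<open>k\<close> provides.

  Contracting \<open>U\<^sub>1 \<union> A\<^sub>2\<close> in \<open>M\<close> and restricting gives \<open>N\<^sub>1\<close>, and because \<open>N\<^sub>1\<close> has a proper
  nonempty cyclic flat other than \<open>A\<^sub>1\<close>, no other contraction does. So an element of \<open>U\<^sub>1\<close> must be
  contracted to obtain \<open>N\<^sub>1\<close> and deleted to obtain \<open>N\<^sub>2\<close>, and vice versa for \<open>U\<^sub>2\<close>; hence no proper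
  minor of \<open>M\<close> has both as minors.\<close>

subsection \<open>Matroids from rank functions\<close>

locale rank_function =
  fixes E :: "'a set" and f :: "'a set \<Rightarrow> nat"
  assumes finite_carrier: "finite E"
    and empty: "f {} = 0"
    and mono: "X \<subseteq> Y \<Longrightarrow> Y \<subseteq> E \<Longrightarrow> f X \<le> f Y"
    and insert_le: "X \<subseteq> E \<Longrightarrow> x \<in> E \<Longrightarrow> f (insert x X) \<le> Suc (f X)"
    and submodular: "X \<subseteq> E \<Longrightarrow> Y \<subseteq> E \<Longrightarrow> f (X \<union> Y) + f (X \<inter> Y) \<le> f X + f Y"
begin

definition rank_matroid :: "'a indep_system" where
  "rank_matroid = \<lparr>ground = E, indeps = {I. I \<subseteq> E \<and> f I = card I}\<rparr>"

lemma finite_sub: "X \<subseteq> E \<Longrightarrow> finite X"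
  using finite_carrier finite_subset by blast

lemma union_le:
  assumes "X \<subseteq> E" and "Y \<subseteq> E"
  shows "f (X \<union> Y) \<le> f X + card Y"
  using finite_sub[OF assms(2)] assms(2)
proof (induction Y rule: finite_induct)
  case (insert y Y)
  then have "f (insert y (X \<union> Y)) \<le> Suc (f (X \<union> Y))"
    using insert_le[of "X \<union> Y" y] assms(1) by simp
  then show ?case using insert by simp
qed simp

lemma le_card: "X \<subseteq> E \<Longrightarrow> f X \<le> card X"
  using union_le[of "{}" X] empty by simp

text \<open>Induction on \<open>X\<close>: submodularity for \<open>I \<union> X\<close> and
  \<open>insert x I\<close>, whose intersection contains \<open>I\<close>, leaves no room for an
  increase.\<close>

lemma span:
  assumes "I \<subseteq> E" and "X \<subseteq> E" and "\<And>x. x \<in> X \<Longrightarrow> f (insert x I) = f I"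
  shows "f (I \<union> X) = f I"
  using finite_sub[OF assms(2)] assms(2,3)
proof (induction X rule: finite_induct)
  case (insert x X)
  have "f ((I \<union> X) \<union> insert x I) + f ((I \<union> X) \<inter> insert x I) \<le> f (I \<union> X) + f (insert x I)"
    using insert assms(1) by (intro submodular) auto
  moreover have "f I \<le> f ((I \<union> X) \<inter> insert x I)"
    using assms(1) insert by (intro mono) auto
  moreover have "f (I \<union> X) = f I" "f (insert x I) = f I" using insert by auto
  moreover have "(I \<union> X) \<union> insert x I = I \<union> insert x X" by auto
  moreover have "f I \<le> f (I \<union> insert x X)" using assms(1) insert by (intro mono) auto
  ultimately show ?case by simp
qed simp

lemma indep_subset:
  assumes "I \<subseteq> E" "f I = card I" "J \<subseteq> I"
  shows "f J = card J"
proof -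
  have "f (J \<union> (I - J)) \<le> f J + card (I - J)"
    using assms by (intro union_le) auto
  moreover have "J \<union> (I - J) = I" using assms by auto
  moreover have "card (I - J) = card I - card J" "card J \<le> card I"
    using assms finite_sub by (auto simp: card_Diff_subset finite_subset card_mono)
  moreover have "f J \<le> card J" using assms by (intro le_card) auto
  ultimately show ?thesis using assms(2) by simp
qed

lemma insert_indep:
  assumes "I \<subseteq> E" "f I = card I" "x \<in> E" "f (insert x I) \<noteq> f I"
  shows "f (insert x I) = card (insert x I)"
proof -
  have "x \<notin> I" using assms(4) by (auto simp: insert_absorb)
  moreover have "f I \<le> f (insert x I)" using assms by (intro mono) auto
  ultimately show ?thesis using assms insert_le[of I x] finite_sub[of I] by simp
qed

text \<open>Augmentation is the main point. If no element of \<open>J\<close> extended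
  \<open>I\<close>, then \<open>span\<close> would give
  \<open>f (I \<union> J) = f I = card I < card J = f J\<close>, against monotonicity.\<close>

lemma matroid_rank_matroid: "matroid rank_matroid"
proof
  fix I J assume I: "I \<in> indeps rank_matroid" and J: "J \<in> indeps rank_matroid"
    and less: "card I < card J"
  show "\<exists>x\<in>J - I. insert x I \<in> indeps rank_matroid"
  proof (rule ccontr)
    assume no: "\<not> ?thesis"
    have "f (insert x I) = f I" if "x \<in> J" for x
    proof (rule ccontr)
      assume ne: "f (insert x I) \<noteq> f I"
      have "I \<subseteq> E" "f I = card I" "x \<in> E" using I J that by (auto simp: rank_matroid_def)
      then have "insert x I \<in> indeps rank_matroid"
        using insert_indep[of I x] ne by (simp add: rank_matroid_def)
      moreover have "x \<notin> I" using ne by (auto simp: insert_absorb)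
      ultimately show False using no that by blast
    qed
    then have "f (I \<union> J) = f I" using I J by (intro span) (auto simp: rank_matroid_def)
    moreover have "f J \<le> f (I \<union> J)" using I J by (intro mono) (auto simp: rank_matroid_def)
    ultimately show False using I J less by (auto simp: rank_matroid_def)
  qed
qed (use finite_carrier empty indep_subset in \<open>auto simp: rank_matroid_def\<close>)

text \<open>An independent \<open>I\<close> of largest size inside \<open>X\<close> spans
  \<open>X\<close>, because by \<open>insert_indep\<close> any element raising \<open>f\<close>
  would enlarge it.\<close>

lemma rank_rank_matroid:
  assumes "X \<subseteq> E"
  shows "rank rank_matroid X = f X"
proof -
  let ?S = "{I. I \<subseteq> X \<and> f I = card I}"
  have fin: "finite ?S" using finite_sub[OF assms] by simp
  have "{} \<in> ?S" using empty by simp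
  then have ne: "card ` ?S \<noteq> {}" by blast
  define m where "m = Max (card ` ?S)"
  have "m \<in> card ` ?S" unfolding m_def using fin ne by (intro Max_in) auto
  then obtain I where I: "I \<subseteq> X" "f I = card I" "card I = m" by auto
  have "f (insert x I) = f I" if "x \<in> X" for x
  proof (rule ccontr)
    assume ne: "f (insert x I) \<noteq> f I"
    then have "f (insert x I) = card (insert x I)"
      using I that assms by (intro insert_indep) auto
    then have "card (insert x I) \<le> m"
      unfolding m_def using I that fin by (intro Max_ge) auto
    moreover have "x \<notin> I" using ne by (auto simp: insert_absorb)
    ultimately show False using I finite_sub[of I] assms by auto
  qed
  then have "f (I \<union> X) = f I" using I assms by (intro span) auto
  then have "f X = m" using I by (simp add: Un_absorb1)
  moreover have "{I \<in> indeps rank_matroid. I \<subseteq> X} = ?S"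
    using assms by (auto simp: rank_matroid_def)
  ultimately show ?thesis unfolding rank_def m_def by simp
qed

end

subsection \<open>Rank and cyclic flats\<close>

context matroid
begin

lemma finite_indep: "I \<in> indeps M \<Longrightarrow> finite I"
  using indeps_subset finite_ground finite_subset by blast

lemma finite_indeps: "finite (indeps M)"
  using indeps_subset finite_ground by (intro finite_subset[of "indeps M" "Pow (ground M)"]) auto

lemma card_le_rank: "I \<in> indeps M \<Longrightarrow> I \<subseteq> X \<Longrightarrow> card I \<le> rank M X"
  unfolding rank_def using finite_indeps by (intro Max_ge) auto

lemma obtain_basis:
  obtains B where "B \<in> indeps M" "B \<subseteq> X" "card B = rank M X"
proof -
  have "rank M X \<in> card ` {I \<in> indeps M. I \<subseteq> X}"
    unfolding rank_def using finite_indeps indeps_empty by (intro Max_in) auto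
  then show ?thesis using that by auto
qed

lemma extend_basis:
  assumes "I \<in> indeps M" "I \<subseteq> X"
  obtains B where "B \<in> indeps M" "I \<subseteq> B" "B \<subseteq> X" "card B = rank M X"
proof -
  have "\<exists>B \<in> indeps M. I \<subseteq> B \<and> B \<subseteq> X \<and> card B = rank M X"
    using assms
  proof (induction "rank M X - card I" arbitrary: I rule: less_induct)
    case less
    obtain J where J: "J \<in> indeps M" "J \<subseteq> X" "card J = rank M X" by (rule obtain_basis)
    show ?case
    proof (cases "card I = rank M X")
      case False
      then have lt: "card I < card J" using card_le_rank[OF less.prems] J by simp
      then obtain x where x: "x \<in> J - I" "insert x I \<in> indeps M"
        using indeps_augment less.prems J by blast
      have "card (insert x I) = Suc (card I)" using x finite_indep less.prems by simp
      then have "rank M X - card (insert x I) < rank M X - card I" using lt J by simp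
      then have "\<exists>B \<in> indeps M. insert x I \<subseteq> B \<and> B \<subseteq> X \<and> card B = rank M X"
        using x J less.prems by (intro less.hyps) auto
      then show ?thesis by auto
    qed (use less in auto)
  qed
  then show ?thesis using that by blast
qed

lemma rank_mono: "X \<subseteq> Y \<Longrightarrow> rank M X \<le> rank M Y"
  by (rule obtain_basis[of X]) (metis card_le_rank order_trans)

lemma rank_le_card: "finite X \<Longrightarrow> rank M X \<le> card X"
  by (rule obtain_basis[of X]) (metis card_mono)

lemma rank_empty: "rank M {} = 0"
  using rank_le_card[of "{}"] by simp

lemma indep_iff: "I \<in> indeps M \<longleftrightarrow> I \<subseteq> ground M \<and> rank M I = card I"
proof
  assume "I \<in> indeps M"
  then show "I \<subseteq> ground M \<and> rank M I = card I"
    using card_le_rank[of I I] rank_le_card[of I] finite_indep[of I] indeps_subset by fastforce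
next
  assume I: "I \<subseteq> ground M \<and> rank M I = card I"
  obtain B where "B \<in> indeps M" "B \<subseteq> I" "card B = rank M I" by (rule obtain_basis)
  then show "I \<in> indeps M"
    using I finite_ground by (metis card_subset_eq finite_subset)
qed

text \<open>Extend a basis of \<open>X \<inter> Y\<close> to a basis \<open>B\<close> of the union
  and count the independent sets \<open>B \<inter> X\<close> and
  \<open>B \<inter> Y\<close>.\<close>

lemma rank_submodular: "rank M (X \<union> Y) + rank M (X \<inter> Y) \<le> rank M X + rank M Y"
proof -
  obtain I where I: "I \<in> indeps M" "I \<subseteq> X \<inter> Y" "card I = rank M (X \<inter> Y)" by (rule obtain_basis)
  obtain B where B: "B \<in> indeps M" "I \<subseteq> B" "B \<subseteq> X \<union> Y" "card B = rank M (X \<union> Y)"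
    using extend_basis[OF I(1), of "X \<union> Y"] I(2) by blast
  have fin: "finite B" using B finite_indep by simp
  have "(B \<inter> X) \<union> (B \<inter> Y) = B" "(B \<inter> X) \<inter> (B \<inter> Y) = B \<inter> X \<inter> Y" using B(3) by auto
  then have "card (B \<inter> X) + card (B \<inter> Y) = card B + card (B \<inter> X \<inter> Y)"
    using card_Un_Int[of "B \<inter> X" "B \<inter> Y"] fin by simp
  moreover have "card I \<le> card (B \<inter> X \<inter> Y)" using I B fin by (intro card_mono) auto
  moreover have "card (B \<inter> X) \<le> rank M X" "card (B \<inter> Y) \<le> rank M Y"
    using B indeps_hereditary by (auto intro!: card_le_rank)
  ultimately show ?thesis using I B by simp
qed

lemma rank_union_le: "finite Y \<Longrightarrow> rank M (X \<union> Y) \<le> rank M X + card Y"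
  using rank_submodular[of X Y] rank_le_card[of Y] by simp

text \<open>The upper-bound half of the rank formula; \<open>Z\<close> may be any set here, not only
  a cyclic flat.\<close>

lemma rank_le_diff: "finite X \<Longrightarrow> rank M X \<le> rank M Z + card (X - Z)"
  using rank_union_le[of "X - Z" Z] rank_mono[of X "Z \<union> (X - Z)"] by auto

lemma rank_function_rank: "rank_function (ground M) (rank M)"
proof
  show "rank M (insert x X) \<le> Suc (rank M X)" for x X
    using rank_union_le[of "{x}" X] by simp
qed (use finite_ground rank_empty rank_mono rank_submodular in auto)

section \<open>Circuits, cyclic flats and the rank formula\<close>

lemma circuit_not_subset_indep: "circuit M C \<Longrightarrow> I \<in> indeps M \<Longrightarrow> \<not> C \<subseteq> I"
  unfolding circuit_def using indeps_hereditary by metis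

lemma obtain_circuit:
  assumes "X \<subseteq> ground M" "X \<notin> indeps M"
  obtains C where "circuit M C" "C \<subseteq> X"
proof -
  have "finite X" using assms finite_ground finite_subset by blast
  then have "\<exists>C. circuit M C \<and> C \<subseteq> X" using assms
  proof (induction X rule: finite_psubset_induct)
    case (psubset X)
    show ?case
    proof (cases "\<forall>Y. Y \<subset> X \<longrightarrow> Y \<in> indeps M")
      case True
      then show ?thesis using psubset unfolding circuit_def by blast
    next
      case False
      then obtain Y where "Y \<subset> X" "Y \<notin> indeps M" by blast
      then show ?thesis using psubset by (meson order_trans psubset_imp_subset)
    qed
  qed
  then show ?thesis using that by blast
qed

text \<open>If the rank dropped, a basis of \<open>X - {x}\<close> containing \<open>C - {x}\<close>
  would extend to a basis of \<open>X\<close> through \<open>x\<close>, which would then contain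
  \<open>C\<close>.\<close>

lemma rank_delete_circuit_element:
  assumes "circuit M C" "x \<in> C" "C \<subseteq> X"
  shows "rank M (X - {x}) = rank M X"
proof (rule ccontr)
  assume "rank M (X - {x}) \<noteq> rank M X"
  then have lt: "rank M (X - {x}) < rank M X" using rank_mono[of "X - {x}" X] by auto
  have "C - {x} \<in> indeps M" using assms unfolding circuit_def by blast
  then obtain B where B: "B \<in> indeps M" "C - {x} \<subseteq> B" "B \<subseteq> X - {x}" "card B = rank M (X - {x})"
    using extend_basis[of "C - {x}" "X - {x}"] assms(3) by blast
  obtain B' where B': "B' \<in> indeps M" "B \<subseteq> B'" "B' \<subseteq> X" "card B' = rank M X"
    using extend_basis[of B X] B by blast
  have "x \<in> B'"
    using card_le_rank[of B' "X - {x}"] B' lt by auto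
  then have "C \<subseteq> B'" using B B' by blast
  then show False using circuit_not_subset_indep[OF assms(1) B'(1)] by simp
qed

text \<open>Adding \<open>x\<close> to a basis of \<open>X - {x}\<close> creates a dependent set,
  and every circuit in it must use \<open>x\<close>.\<close>

lemma circuit_through:
  assumes "X \<subseteq> ground M" "x \<in> X" "rank M (X - {x}) = rank M X"
  obtains C where "circuit M C" "x \<in> C" "C \<subseteq> X"
proof -
  obtain B where B: "B \<in> indeps M" "B \<subseteq> X - {x}" "card B = rank M (X - {x})"
    by (rule obtain_basis)
  have "card (insert x B) = Suc (rank M X)"
    using B assms finite_indep by (subst card_insert_disjoint) auto
  then have "insert x B \<notin> indeps M"
    using card_le_rank[of "insert x B" X] B assms by auto
  then obtain C where C: "circuit M C" "C \<subseteq> insert x B"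
    using obtain_circuit[of "insert x B"] assms B by blast
  then have "x \<in> C" using circuit_not_subset_indep[OF C(1) B(1)] by blast
  moreover have "C \<subseteq> X" using C B assms(2) by auto
  ultimately show ?thesis using that C(1) by simp
qed

text \<open>An element of \<open>F\<close> lies on a circuit inside \<open>F\<close> exactly when
  its deletion keeps the rank. This lets cyclic flats be handled through the rank function
  alone.\<close>

lemma cyclic_flat_iff:
  "cyclic_flat M F \<longleftrightarrow> flat M F \<and> (\<forall>x\<in>F. rank M (F - {x}) = rank M F)"
proof
  assume cf: "cyclic_flat M F"
  then obtain \<C> where \<C>: "\<forall>C\<in>\<C>. circuit M C" "F = \<Union>\<C>" unfolding cyclic_flat_def by blast
  have "rank M (F - {x}) = rank M F" if "x \<in> F" for x
    using \<C> that rank_delete_circuit_element[of _ x F] by blast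
  then show "flat M F \<and> (\<forall>x\<in>F. rank M (F - {x}) = rank M F)"
    using cf unfolding cyclic_flat_def by blast
next
  assume F: "flat M F \<and> (\<forall>x\<in>F. rank M (F - {x}) = rank M F)"
  then have "F \<subseteq> ground M" unfolding flat_def by blast
  have "\<exists>C. circuit M C \<and> x \<in> C \<and> C \<subseteq> F" if "x \<in> F" for x
    using circuit_through[OF \<open>F \<subseteq> ground M\<close> that] F that by metis
  then have "F = \<Union>{C. circuit M C \<and> C \<subseteq> F}" by (intro equalityI subsetI) auto
  moreover have "\<forall>C\<in>{C. circuit M C \<and> C \<subseteq> F}. circuit M C" by simp
  ultimately have "\<exists>\<C>. (\<forall>C\<in>\<C>. circuit M C) \<and> F = \<Union>\<C>" by (intro exI conjI)
  then show "cyclic_flat M F" using F unfolding cyclic_flat_def by simp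
qed

lemma cyclic_flatD:
  assumes "cyclic_flat M F"
  shows "F \<subseteq> ground M" "finite F"
    "x \<in> F \<Longrightarrow> rank M (F - {x}) = rank M F"
    "x \<in> ground M \<Longrightarrow> x \<notin> F \<Longrightarrow> rank M F < rank M (insert x F)"
  using assms finite_ground finite_subset unfolding cyclic_flat_iff flat_def by auto

lemma flat_rank_less:
  assumes "cyclic_flat M F" "X \<subseteq> ground M" "\<not> X \<subseteq> F"
  shows "rank M F < rank M (F \<union> X)"
proof -
  obtain x where "x \<in> X" "x \<notin> F" using assms by blast
  then have "rank M F < rank M (insert x F)" using cyclic_flatD(4)[OF assms(1)] assms(2) by blast
  also have "\<dots> \<le> rank M (F \<union> X)" using \<open>x \<in> X\<close> by (intro rank_mono) auto
  finally show ?thesis .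
qed

text \<open>One element of \<open>F - X\<close> can be deleted from \<open>F\<close> at no cost,
  which gains one over \<open>rank_le_diff\<close>. For \<open>X \<subset> F\<close> this is strict
  monotonicity of the nullity.\<close>

lemma cyclic_rank_less:
  assumes "cyclic_flat M F" "\<not> F \<subseteq> X"
  shows "rank M F < rank M X + card (F - X)"
proof -
  obtain x where x: "x \<in> F" "x \<notin> X" using assms by blast
  have "rank M F = rank M (F - {x})" using cyclic_flatD(3)[OF assms(1) x(1)] by simp
  also have "\<dots> \<le> rank M X + card (F - {x} - X)"
    using cyclic_flatD(2)[OF assms(1)] by (intro rank_le_diff) auto
  also have "card (F - {x} - X) < card (F - X)"
    using cyclic_flatD(2)[OF assms(1)] x by (intro psubset_card_mono) auto
  finally show ?thesis by simp
qed

text \<open>\<open>J\<close> is the closure of \<open>X\<close>. Deleting a point of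
  \<open>J - X\<close> leaves a superset of \<open>X\<close>, and for a point of \<open>X\<close>
  the hypothesis applies, so \<open>J\<close> is cyclic too.\<close>

lemma closure_cyclic:
  assumes X: "X \<subseteq> ground M" and cyc: "\<And>x. x \<in> X \<Longrightarrow> rank M (X - {x}) = rank M X"
  obtains J where "cyclic_flat M J" "X \<subseteq> J" "rank M J = rank M X"
proof -
  interpret rk: rank_function "ground M" "rank M" by (rule rank_function_rank)
  define J where "J = {x \<in> ground M. rank M (insert x X) = rank M X}"
  have XJ: "X \<subseteq> J" using X by (auto simp: J_def insert_absorb)
  have "rank M (X \<union> J) = rank M X" using X by (intro rk.span) (auto simp: J_def)
  then have rJ: "rank M J = rank M X" using XJ by (simp add: Un_absorb1)
  have "rank M J < rank M (insert x J)" if "x \<in> ground M - J" for x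
  proof -
    have "rank M (insert x X) \<noteq> rank M X" using that by (auto simp: J_def)
    then have "rank M X < rank M (insert x X)"
      using rank_mono[of X "insert x X"] by (simp add: subset_insertI)
    also have "\<dots> \<le> rank M (insert x J)" using XJ by (intro rank_mono) auto
    finally show ?thesis using rJ by simp
  qed
  then have "flat M J" unfolding flat_def J_def by blast
  moreover have "rank M (J - {x}) = rank M J" if "x \<in> J" for x
  proof -
    have "rank M (X - {x}) = rank M X"
      by (cases "x \<in> X") (use cyc in auto)
    moreover have "rank M (X - {x}) \<le> rank M (J - {x})" "rank M (J - {x}) \<le> rank M J"
      using XJ by (auto intro!: rank_mono)
    ultimately show ?thesis using rJ by simp
  qed
  ultimately have "cyclic_flat M J" by (simp add: cyclic_flat_iff)
  then show ?thesis using that XJ rJ by simp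
qed

text \<open>This is \<open>X\<close> without the coloops of the restriction of \<open>M\<close> to
  \<open>X\<close>.\<close>

definition cyclic_part :: "'a set \<Rightarrow> 'a set" where
  "cyclic_part X = \<Union>{C. circuit M C \<and> C \<subseteq> X}"

lemma cyclic_part_subset: "cyclic_part X \<subseteq> X"
  unfolding cyclic_part_def by blast

lemma circuit_subset_cyclic_part: "circuit M C \<Longrightarrow> C \<subseteq> X \<Longrightarrow> C \<subseteq> cyclic_part X"
  unfolding cyclic_part_def by blast

lemma rank_cyclic_part_delete:
  assumes "x \<in> cyclic_part X"
  shows "rank M (cyclic_part X - {x}) = rank M (cyclic_part X)"
proof -
  obtain C where "circuit M C" "C \<subseteq> X" "x \<in> C" using assms unfolding cyclic_part_def by blast
  then show ?thesis using circuit_subset_cyclic_part rank_delete_circuit_element by simp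
qed

text \<open>A basis of the cyclic part stays independent when all remaining elements of
  \<open>X\<close> are added: a circuit in the result would lie in the cyclic part, hence in the
  basis.\<close>

lemma rank_cyclic_part:
  assumes X: "X \<subseteq> ground M"
  shows "rank M X = rank M (cyclic_part X) + card (X - cyclic_part X)"
proof -
  have finX: "finite X" using X finite_ground finite_subset by blast
  obtain B where B: "B \<in> indeps M" "B \<subseteq> cyclic_part X" "card B = rank M (cyclic_part X)"
    by (rule obtain_basis)
  have sub: "B \<union> (X - cyclic_part X) \<subseteq> X" using B(2) cyclic_part_subset[of X] by blast
  have "B \<union> (X - cyclic_part X) \<in> indeps M"
  proof (rule ccontr)
    assume "\<not> ?thesis"
    then obtain C where C: "circuit M C" "C \<subseteq> B \<union> (X - cyclic_part X)"
      by (rule obtain_circuit[OF order_trans[OF sub X]])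
    have "C \<subseteq> cyclic_part X"
      using circuit_subset_cyclic_part[OF C(1) order_trans[OF C(2) sub]] .
    then have "C \<subseteq> B" using C(2) by blast
    then show False using circuit_not_subset_indep[OF C(1) B(1)] by simp
  qed
  then have "card (B \<union> (X - cyclic_part X)) \<le> rank M X" using sub by (rule card_le_rank)
  moreover have "card (B \<union> (X - cyclic_part X)) = card B + card (X - cyclic_part X)"
    using B finite_indep[OF B(1)] finX by (intro card_Un_disjoint) auto
  ultimately show ?thesis using rank_le_diff[OF finX, of "cyclic_part X"] B(3) by simp
qed

text \<open>The minimum in the rank formula is attained at the closure of the cyclic part of
  \<open>X\<close>.\<close>

lemma rank_by_cyclic_flat:
  assumes X: "X \<subseteq> ground M"
  obtains Z where "cyclic_flat M Z" "rank M X = rank M Z + card (X - Z)"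
proof (rule closure_cyclic[of "cyclic_part X"])
  show "cyclic_part X \<subseteq> ground M" using cyclic_part_subset X by (rule order_trans)
  show "rank M (cyclic_part X - {x}) = rank M (cyclic_part X)" if "x \<in> cyclic_part X" for x
    using that by (rule rank_cyclic_part_delete)
  fix Z assume Z: "cyclic_flat M Z" "cyclic_part X \<subseteq> Z" "rank M Z = rank M (cyclic_part X)"
  have finX: "finite X" using X finite_ground finite_subset by blast
  have "card (X - Z) \<le> card (X - cyclic_part X)" using finX Z by (intro card_mono) auto
  then have "rank M X = rank M Z + card (X - Z)"
    using rank_le_diff[OF finX, of Z] rank_cyclic_part[OF X] Z by simp
  then show ?thesis using that[OF Z(1)] by simp
qed

text \<open>This is the meet of \<open>F\<close> and \<open>G\<close> among cyclic flats. A point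
  that fails to raise the rank lies on a circuit whose other points are in
  \<open>F \<inter> G\<close>; since both are flats, the point is in \<open>F \<inter> G\<close>
  too, and so the circuit is in the cyclic part.\<close>

lemma cyclic_flat_cyclic_part:
  assumes F: "cyclic_flat M F" and G: "cyclic_flat M G"
  shows "cyclic_flat M (cyclic_part (F \<inter> G))"
proof -
  let ?W = "cyclic_part (F \<inter> G)"
  have FG: "?W \<subseteq> ground M" "?W \<subseteq> F" "?W \<subseteq> G"
    using cyclic_flatD(1)[OF F] cyclic_part_subset[of "F \<inter> G"] by auto
  have "rank M ?W < rank M (insert x ?W)" if x: "x \<in> ground M - ?W" for x
  proof (rule ccontr)
    assume "\<not> ?thesis"
    then have "rank M (insert x ?W - {x}) = rank M (insert x ?W)"
      using rank_mono[of ?W "insert x ?W"] x by auto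
    then obtain C where C: "circuit M C" "x \<in> C" "C \<subseteq> insert x ?W"
      using circuit_through[of "insert x ?W" x] x FG by auto
    have in_flat: "x \<in> H" if H: "cyclic_flat M H" "?W \<subseteq> H" for H
    proof (rule ccontr)
      assume xH: "x \<notin> H"
      have "C \<subseteq> insert x H" using C(3) H(2) by blast
      then have "rank M (insert x H - {x}) = rank M (insert x H)"
        by (rule rank_delete_circuit_element[OF C(1,2)])
      then show False using cyclic_flatD(4)[OF H(1) _ xH] x xH by simp
    qed
    have "x \<in> F \<inter> G" using in_flat[OF F] in_flat[OF G] FG by simp
    then have "C \<subseteq> ?W" using circuit_subset_cyclic_part[OF C(1), of "F \<inter> G"] C(3) FG by blast
    then show False using C(2) x by blast
  qed
  then show ?thesis
    using FG(1) rank_cyclic_part_delete unfolding cyclic_flat_iff flat_def by simp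
qed

lemma cyclic_flats_join:
  assumes F: "cyclic_flat M F" and G: "cyclic_flat M G"
  obtains J where "cyclic_flat M J" "F \<union> G \<subseteq> J" "rank M J = rank M (F \<union> G)"
proof (rule closure_cyclic[of "F \<union> G"])
  show "F \<union> G \<subseteq> ground M" using cyclic_flatD(1) F G by blast
  obtain \<C> \<D> where "\<forall>C\<in>\<C>. circuit M C" "F = \<Union>\<C>" "\<forall>C\<in>\<D>. circuit M C" "G = \<Union>\<D>"
    using F G unfolding cyclic_flat_def by metis
  then show "rank M (F \<union> G - {x}) = rank M (F \<union> G)" if "x \<in> F \<union> G" for x
    using that rank_delete_circuit_element[of _ x "F \<union> G"] by blast
qed (use that in blast)

text \<open>With only the empty set and the ground set available as cyclic flats, the rank of
  \<open>X\<close> is \<open>card X\<close> or the full rank. Contrapositively, a nonuniform matroid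
  has a nonempty proper cyclic flat.\<close>

lemma uniformI:
  assumes "proper_cyclic_flats M = {}"
  shows "uniform M"
  unfolding uniform_def
proof (intro exI)
  show "indeps M = {X. X \<subseteq> ground M \<and> card X \<le> rank M (ground M)}"
  proof (intro equalityI subsetI CollectI conjI)
    fix X assume X: "X \<in> {X. X \<subseteq> ground M \<and> card X \<le> rank M (ground M)}"
    then obtain Z where Z: "cyclic_flat M Z" "rank M X = rank M Z + card (X - Z)"
      using rank_by_cyclic_flat[of X] by blast
    have "Z = {} \<or> Z = ground M" using Z assms unfolding proper_cyclic_flats_def by blast
    then have "card X \<le> rank M X" using Z X by auto
    moreover have "finite X" using X finite_ground finite_subset by blast
    ultimately show "X \<in> indeps M" using rank_le_card[of X] X indep_iff by auto
  qed (use indeps_subset card_le_rank in auto)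
qed

end

lemma matroid_eqI_cyclic_flats:
  assumes M: "matroid M" and N: "matroid N" and ground: "ground M = ground N"
    and flats: "{(Y, rank M Y) | Y. cyclic_flat M Y} = {(Y, rank N Y) | Y. cyclic_flat N Y}"
  shows "M = N"
proof -
  \<comment> \<open>A cyclic flat attaining the rank of \<open>X\<close> in \<open>N'\<close> is an
    admissible term for \<open>M'\<close>; using this in both directions gives equality.\<close>
  have le: "rank M' X \<le> rank N' X"
    if M': "matroid M'" and N': "matroid N'" and X: "X \<subseteq> ground N'"
      and flats': "{(Y, rank N' Y) | Y. cyclic_flat N' Y} = {(Y, rank M' Y) | Y. cyclic_flat M' Y}"
    for M' N' :: "'a indep_system" and X
  proof -
    obtain Z where Z: "cyclic_flat N' Z" "rank N' X = rank N' Z + card (X - Z)"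
      by (rule matroid.rank_by_cyclic_flat[OF N' X])
    then have "(Z, rank N' Z) \<in> {(Y, rank M' Y) | Y. cyclic_flat M' Y}"
      unfolding flats'[symmetric] by blast
    then have "rank N' Z = rank M' Z" by simp
    moreover have "finite X" using X matroid.finite_ground[OF N'] finite_subset by blast
    ultimately show ?thesis using matroid.rank_le_diff[OF M', of X Z] Z by simp
  qed
  have "rank M X = rank N X" if "X \<subseteq> ground M" for X
    using le[OF M N _ flats[symmetric], of X] le[OF N M _ flats, of X] that ground by simp
  then have "I \<in> indeps M \<longleftrightarrow> I \<in> indeps N" for I
    unfolding matroid.indep_iff[OF M] matroid.indep_iff[OF N] ground by auto
  then have "indeps M = indeps N" by blast
  then show ?thesis using ground by (intro indep_system.equality) auto
qed

subsection \<open>Matroids from ranked families of cyclic flats\<close>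

text \<open>Join and meet of cyclic flats are only required to exist in the weak form that makes the
  rank formula submodular.\<close>

locale cyclic_flat_system =
  fixes E :: "'a set" and P :: "('a set \<times> nat) set"
  assumes finite_E: "finite E"
    and subset_E: "(Z, n) \<in> P \<Longrightarrow> Z \<subseteq> E"
    and empty_in: "({}, 0) \<in> P"
    and functional: "(Z, m) \<in> P \<Longrightarrow> (Z, n) \<in> P \<Longrightarrow> m = n"
    and strict: "(W, m) \<in> P \<Longrightarrow> (Z, n) \<in> P \<Longrightarrow> W \<subset> Z \<Longrightarrow> m < n \<and> n < m + card (Z - W)"
    and join_meet: "(Y, m) \<in> P \<Longrightarrow> (Z, n) \<in> P \<Longrightarrow>
      \<exists>J j W w. (J, j) \<in> P \<and> (W, w) \<in> P \<and> Y \<union> Z \<subseteq> J \<and> W \<subseteq> Y \<inter> Z \<and>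
        j + w + card (Y \<inter> Z - W) \<le> m + n"
begin

definition rk :: "'a set \<Rightarrow> nat" where
  "rk X = Min ((\<lambda>(Z, n). n + card (X - Z)) ` P)"

lemma finite_P: "finite P"
proof (rule finite_imageD[of fst])
  show "finite (fst ` P)"
    using subset_E finite_E by (intro finite_subset[of "fst ` P" "Pow E"]) (auto, blast)
  show "inj_on fst P" using functional by (auto simp: inj_on_def)
qed

lemma rk_le: "(Z, n) \<in> P \<Longrightarrow> rk X \<le> n + card (X - Z)"
  unfolding rk_def using finite_P by (intro Min_le) force+

lemma rk_attained: obtains Z n where "(Z, n) \<in> P" "rk X = n + card (X - Z)"
proof -
  have "rk X \<in> (\<lambda>(Z, n). n + card (X - Z)) ` P"
    unfolding rk_def using finite_P empty_in by (intro Min_in) auto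
  then show ?thesis using that by auto
qed

lemma finite_subset_E: "X \<subseteq> E \<Longrightarrow> finite X"
  using finite_E finite_subset by blast

lemma rk_submodular:
  assumes "X \<subseteq> E" "Y \<subseteq> E"
  shows "rk (X \<union> Y) + rk (X \<inter> Y) \<le> rk X + rk Y"
proof -
  obtain A a where A: "(A, a) \<in> P" "rk X = a + card (X - A)" by (rule rk_attained)
  obtain B b where B: "(B, b) \<in> P" "rk Y = b + card (Y - B)" by (rule rk_attained)
  obtain J j W w where JW: "(J, j) \<in> P" "(W, w) \<in> P" "A \<union> B \<subseteq> J" "W \<subseteq> A \<inter> B"
    "j + w + card (A \<inter> B - W) \<le> a + b"
    using join_meet[OF A(1) B(1)] by blast
  have fin: "finite X" "finite Y" "finite A" using assms finite_subset_E subset_E[OF A(1)] by auto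
  \<comment> \<open>Since \<open>W \<subseteq> A \<inter> B\<close>, the set \<open>?T\<close> is
    \<open>X \<inter> Y - A \<inter> B\<close>. Points of \<open>?S\<close> or \<open>?T\<close> are
    counted by \<open>X - A\<close> or \<open>Y - B\<close>, and points of both are counted
    twice.\<close>
  let ?S = "X \<union> Y - J" and ?T = "(X \<inter> Y - W) - (A \<inter> B - W)"
  have "card (X \<inter> Y - W) \<le> card (?T \<union> (A \<inter> B - W))" using fin by (intro card_mono) auto
  also have "\<dots> \<le> card ?T + card (A \<inter> B - W)" by (rule card_Un_le)
  finally have 1: "card (X \<inter> Y - W) \<le> card ?T + card (A \<inter> B - W)" .
  have "card ?S + card ?T = card (?S \<union> ?T) + card (?S \<inter> ?T)"
    using fin by (intro card_Un_Int) auto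
  also have "card (?S \<union> ?T) \<le> card ((X - A) \<union> (Y - B))"
    using fin JW by (intro card_mono) auto
  also have "card (?S \<inter> ?T) \<le> card ((X - A) \<inter> (Y - B))"
    using fin JW by (intro card_mono) auto
  also have "card ((X - A) \<union> (Y - B)) + card ((X - A) \<inter> (Y - B)) = card (X - A) + card (Y - B)"
    using fin by (intro card_Un_Int[symmetric]) auto
  finally have 2: "card ?S + card ?T \<le> card (X - A) + card (Y - B)" by simp
  show ?thesis
    using 1 2 JW(5) A(2) B(2) rk_le[OF JW(1), of "X \<union> Y"] rk_le[OF JW(2), of "X \<inter> Y"] by linarith
qed

sublocale rank_function E rk
proof
  show "finite E" by (rule finite_E)
  show "rk {} = 0" using rk_le[OF empty_in, of "{}"] by simp
  show "rk X \<le> rk Y" if "X \<subseteq> Y" "Y \<subseteq> E" for X Y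
  proof -
    obtain Z n where Z: "(Z, n) \<in> P" "rk Y = n + card (Y - Z)" by (rule rk_attained)
    have "card (X - Z) \<le> card (Y - Z)" using that finite_subset_E by (intro card_mono) auto
    then show ?thesis using rk_le[OF Z(1), of X] Z(2) by linarith
  qed
  show "rk (insert x X) \<le> Suc (rk X)" if "X \<subseteq> E" "x \<in> E" for x X
  proof -
    obtain Z n where Z: "(Z, n) \<in> P" "rk X = n + card (X - Z)" by (rule rk_attained)
    have "card (insert x X - Z) \<le> card (insert x (X - Z))"
      using finite_subset_E[OF that(1)] by (intro card_mono) auto
    also have "\<dots> \<le> Suc (card (X - Z))" by (rule card_insert_le_m1) auto
    finally show ?thesis using rk_le[OF Z(1), of "insert x X"] Z(2) by linarith
  qed
qed (rule rk_submodular)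

text \<open>Let \<open>Y\<close> attain the minimum for \<open>Z\<close>. Adding
  \<open>n \<le> j\<close> and \<open>n \<le> w + card (Z - W)\<close> and applying the submodular
  inequality to \<open>Z\<close> and \<open>Y\<close> gives
  \<open>n \<le> m + card (Z - Y)\<close>.\<close>

lemma rk_member:
  assumes Z: "(Z, n) \<in> P"
  shows "rk Z = n"
proof -
  obtain Y m where Y: "(Y, m) \<in> P" "rk Z = m + card (Z - Y)" by (rule rk_attained)
  obtain J j W w where JW: "(J, j) \<in> P" "(W, w) \<in> P" "Z \<union> Y \<subseteq> J" "W \<subseteq> Z \<inter> Y"
    "j + w + card (Z \<inter> Y - W) \<le> n + m"
    using join_meet[OF Z Y(1)] by blast
  have finZ: "finite Z" using subset_E[OF Z] finite_sub by simp
  have "n \<le> j"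
    using functional[OF Z, of j] strict[OF Z JW(1)] JW(1,3) by (cases "Z = J") (auto simp: psubset_eq)
  moreover have "n \<le> w + card (Z - W)"
    using functional[OF Z, of w] strict[OF JW(2) Z] JW(2,4) by (cases "Z = W") (auto simp: psubset_eq)
  moreover have "card (Z - W) = card (Z - Y) + card (Z \<inter> Y - W)"
  proof -
    have "Z - W = (Z - Y) \<union> (Z \<inter> Y - W)" using JW(4) by auto
    then show ?thesis using finZ by (simp add: card_Un_disjoint Int_Diff disjoint_iff)
  qed
  ultimately have "n \<le> rk Z" using JW(5) Y(2) by linarith
  then show ?thesis using rk_le[OF Z, of Z] by simp
qed

lemma ground_rank_matroid [simp]: "ground rank_matroid = E"
  by (simp add: rank_matroid_def)

text \<open>The computation of \<open>rk_member\<close> is repeated with one strict inequality: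
  \<open>n < j\<close> for flatness, as the join contains the new point, and
  \<open>n < w + card (Z - W)\<close> for cyclicity, as the meet misses the deleted point.\<close>

lemma cyclic_flat_member:
  assumes Z: "(Z, n) \<in> P"
  shows "cyclic_flat rank_matroid Z"
proof -
  note ZE = subset_E[OF Z] and rZ = rk_member[OF Z]
  have finZ: "finite Z" using ZE finite_sub by simp
  have "rk Z < rk (insert x Z)" if x: "x \<in> E - Z" for x
  proof -
    obtain Y m where Y: "(Y, m) \<in> P" "rk (insert x Z) = m + card (insert x Z - Y)"
      by (rule rk_attained)
    show ?thesis
    proof (cases "x \<in> Y")
      case False
      then have "card (insert x Z - Y) = Suc (card (Z - Y))"
        using finZ x by (simp add: insert_Diff_if)
      then show ?thesis using Y rk_le[OF Y(1), of Z] by simp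
    next
      case True
      obtain J j W w where JW: "(J, j) \<in> P" "(W, w) \<in> P" "Z \<union> Y \<subseteq> J" "W \<subseteq> Z \<inter> Y"
        "j + w + card (Z \<inter> Y - W) \<le> n + m"
        using join_meet[OF Z Y(1)] by blast
      have "n < j" using strict[OF Z JW(1)] JW(3) True x by blast
      moreover have "n \<le> w + card (Z - W)"
        using rk_le[OF JW(2), of Z] rZ by simp
      moreover have "card (Z - W) \<le> card (Z - Y) + card (Z \<inter> Y - W)"
      proof -
        have "Z - W \<subseteq> (Z - Y) \<union> (Z \<inter> Y - W)" by auto
        then have "card (Z - W) \<le> card ((Z - Y) \<union> (Z \<inter> Y - W))"
          using finZ by (intro card_mono) auto
        then show ?thesis using card_Un_le[of "Z - Y" "Z \<inter> Y - W"] by linarith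
      qed
      moreover have "insert x Z - Y = Z - Y" using True by auto
      ultimately show ?thesis using JW(5) Y(2) rZ by simp
    qed
  qed
  moreover have "rk (Z - {x}) = rk Z" if x: "x \<in> Z" for x
  proof (rule antisym)
    show "rk (Z - {x}) \<le> rk Z" using ZE by (intro mono) auto
    obtain Y m where Y: "(Y, m) \<in> P" "rk (Z - {x}) = m + card (Z - {x} - Y)"
      by (rule rk_attained)
    show "rk Z \<le> rk (Z - {x})"
    proof (cases "x \<in> Y")
      case True
      then have "Z - {x} - Y = Z - Y" by auto
      then show ?thesis using rk_le[OF Y(1), of Z] Y(2) by simp
    next
      case False
      obtain J j W w where JW: "(J, j) \<in> P" "(W, w) \<in> P" "Z \<union> Y \<subseteq> J" "W \<subseteq> Z \<inter> Y"
        "j + w + card (Z \<inter> Y - W) \<le> n + m"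
        using join_meet[OF Z Y(1)] by blast
      have "n \<le> j" using mono[OF _ subset_E[OF JW(1)], of Z] JW(3) rZ rk_member[OF JW(1)] by simp
      moreover have "n < w + card (Z - W)" using strict[OF JW(2) Z] JW(4) False x by blast
      \<comment> \<open>The \<open>Suc\<close> accounts for \<open>x\<close> and is absorbed by the
        strict inequality just obtained.\<close>
      moreover have "card (Z - W) \<le> Suc (card (Z - {x} - Y)) + card (Z \<inter> Y - W)"
      proof -
        have "Z - W \<subseteq> insert x (Z - {x} - Y) \<union> (Z \<inter> Y - W)" by auto
        then have "card (Z - W) \<le> card (insert x (Z - {x} - Y) \<union> (Z \<inter> Y - W))"
          using finZ by (intro card_mono) auto
        also have "\<dots> \<le> card (insert x (Z - {x} - Y)) + card (Z \<inter> Y - W)" by (rule card_Un_le)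
        also have "card (insert x (Z - {x} - Y)) = Suc (card (Z - {x} - Y))" using finZ by simp
        finally show ?thesis by simp
      qed
      ultimately show ?thesis using JW(5) Y(2) rZ by linarith
    qed
  qed
  moreover have "Z - {x} \<subseteq> E" for x using ZE by blast
  ultimately show ?thesis
    using ZE rank_rank_matroid
    unfolding matroid.cyclic_flat_iff[OF matroid_rank_matroid] flat_def by simp
qed

text \<open>The member \<open>Z\<close> attaining \<open>rk X\<close> must be \<open>X\<close>. A
  point of \<open>X - Z\<close> could be deleted with a drop in rank, so cyclicity gives
  \<open>X \<subseteq> Z\<close>; then \<open>rk Z = rk X\<close>, and flatness gives
  \<open>Z \<subseteq> X\<close>.\<close>

lemma cyclic_flat_in:
  assumes X: "cyclic_flat rank_matroid X"
  shows "(X, rk X) \<in> P"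
proof -
  interpret rm: matroid rank_matroid by (rule matroid_rank_matroid)
  have XE: "X \<subseteq> E" using rm.cyclic_flatD(1)[OF X] by simp
  have finX: "finite X" using XE finite_sub by simp
  obtain Z n where Z: "(Z, n) \<in> P" "rk X = n + card (X - Z)" by (rule rk_attained)
  have XZ: "X \<subseteq> Z"
  proof
    fix x assume x: "x \<in> X"
    show "x \<in> Z"
    proof (rule ccontr)
      assume "x \<notin> Z"
      then have "X - {x} - Z \<subset> X - Z" using x by auto
      then have "card (X - {x} - Z) < card (X - Z)" using finX by (intro psubset_card_mono) auto
      moreover have "rk (X - {x}) = rk X"
        using rm.cyclic_flatD(3)[OF X x] XE rank_rank_matroid[of X] rank_rank_matroid[of "X - {x}"]
        by (simp add: subset_iff)
      ultimately show False using rk_le[OF Z(1), of "X - {x}"] Z(2) by linarith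
    qed
  qed
  then have "rk X = n" using Z(2) by (simp add: Diff_eq_empty_iff[THEN iffD2])
  moreover have "Z \<subseteq> X"
  proof (rule ccontr)
    assume "\<not> Z \<subseteq> X"
    then have "rank rank_matroid X < rank rank_matroid (X \<union> Z)"
      using rm.flat_rank_less[OF X] subset_E[OF Z(1)] by simp
    then show False
      using rank_rank_matroid XE subset_E[OF Z(1)] XZ rk_member[OF Z(1)] \<open>rk X = n\<close>
      by (simp add: Un_absorb1)
  qed
  ultimately show ?thesis using Z(1) XZ by simp
qed

lemma cyclic_flats_rank_matroid:
  "{(Y, rank rank_matroid Y) | Y. cyclic_flat rank_matroid Y} = P"
proof (intro equalityI subsetI)
  fix p assume "p \<in> {(Y, rank rank_matroid Y) | Y. cyclic_flat rank_matroid Y}"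
  then obtain Y where Y: "p = (Y, rank rank_matroid Y)" "cyclic_flat rank_matroid Y" by blast
  then show "p \<in> P"
    using cyclic_flat_in[OF Y(2)] subset_E rank_rank_matroid by metis
next
  fix p assume "p \<in> P"
  then obtain Z n where Z: "p = (Z, n)" "(Z, n) \<in> P" by (cases p) auto
  then have "p = (Z, rank rank_matroid Z)"
    using rank_rank_matroid[OF subset_E[OF Z(2)]] rk_member[OF Z(2)] by simp
  then show "p \<in> {(Y, rank rank_matroid Y) | Y. cyclic_flat rank_matroid Y}"
    using cyclic_flat_member[OF Z(2)] by blast
qed

end

subsection \<open>Minors\<close>

context matroid
begin

lemma
  assumes C: "C \<subseteq> ground M"
  shows matroid_minor: "matroid (delete (contract M C) D)"
    and rank_minor: "X \<subseteq> ground M - C - D \<Longrightarrow>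
      rank (delete (contract M C) D) X + rank M C = rank M (X \<union> C)"
proof -
  \<comment> \<open>Keeps the natural-number subtractions below from truncating.\<close>
  have ge: "rank M C \<le> rank M (X \<union> C)" for X by (intro rank_mono) auto
  interpret rk: rank_function "ground M - C - D" "\<lambda>X. rank M (X \<union> C) - rank M C"
  proof
    show "finite (ground M - C - D)" using finite_ground by simp
    show "rank M (X \<union> C) - rank M C \<le> rank M (Y \<union> C) - rank M C" if "X \<subseteq> Y" for X Y
      using that by (intro diff_le_mono rank_mono) auto
    show "rank M (insert x X \<union> C) - rank M C \<le> Suc (rank M (X \<union> C) - rank M C)" for x X
      using rank_union_le[of "{x}" "X \<union> C"] by simp
    show "rank M (X \<union> Y \<union> C) - rank M C + (rank M (X \<inter> Y \<union> C) - rank M C)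
        \<le> rank M (X \<union> C) - rank M C + (rank M (Y \<union> C) - rank M C)" for X Y
    proof -
      have "(X \<union> C) \<union> (Y \<union> C) = X \<union> Y \<union> C" "(X \<union> C) \<inter> (Y \<union> C) = X \<inter> Y \<union> C" by auto
      then show ?thesis
        using rank_submodular[of "X \<union> C" "Y \<union> C"] ge[of X] ge[of Y] ge[of "X \<union> Y"] ge[of "X \<inter> Y"]
        by simp
    qed
  qed simp
  have "delete (contract M C) D = rk.rank_matroid"
    unfolding delete_def contract_def rk.rank_matroid_def
    using ge by (intro indep_system.equality) (auto simp: le_imp_diff_is_add add.commute)
  then show "matroid (delete (contract M C) D)"
    and "X \<subseteq> ground M - C - D \<Longrightarrow>
      rank (delete (contract M C) D) X + rank M C = rank M (X \<union> C)"
    using rk.matroid_rank_matroid rk.rank_rank_matroid ge by simp_all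
qed

lemma minor_eqI:
  assumes N: "matroid N" and "ground N = ground M - C - D"
    and rank: "\<And>X. X \<subseteq> ground N \<Longrightarrow> rank N X + rank M C = rank M (X \<union> C)"
  shows "N = delete (contract M C) D"
proof (rule indep_system.equality)
  show ground: "ground N = ground (delete (contract M C) D)"
    using assms by (simp add: delete_def contract_def)
  have "I \<in> indeps N \<longleftrightarrow> I \<in> indeps (delete (contract M C) D)" for I
    using rank[of I] assms(2) unfolding matroid.indep_iff[OF N]
    by (auto simp: delete_def contract_def)
  then show "indeps N = indeps (delete (contract M C) D)" by blast
qed simp

lemma delete_contract_empty: "delete (contract M {}) {} = M"
  using indeps_subset rank_empty
  by (intro indep_system.equality) (auto simp: delete_def contract_def indep_iff)

text \<open>Telescoping the rank identities of the two contractions makes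
  \<open>C' \<union> C\<close> the contracted set of \<open>N\<close> inside \<open>M\<close>. Only
  this set and its rank identity are recorded, not a deleted set.\<close>

lemma minor_of_minorE:
  assumes CD: "C \<subseteq> ground M" and N: "minor_of N (delete (contract M C) D)"
  obtains C' where "C' \<subseteq> ground M - C - D - ground N" "ground N \<subseteq> ground M - C - D"
    "\<And>X. X \<subseteq> ground N \<Longrightarrow> rank N X + rank M (C' \<union> C) = rank M (X \<union> (C' \<union> C))"
proof -
  let ?L = "delete (contract M C) D"
  have gL: "ground ?L = ground M - C - D" by (simp add: delete_def contract_def)
  obtain C' D' where N': "C' \<subseteq> ground ?L" "N = delete (contract ?L C') D'"
    using N unfolding minor_of_def by blast
  have gN: "ground N = ground ?L - C' - D'" unfolding N'(2) by (simp add: delete_def contract_def)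
  interpret L: matroid ?L by (rule matroid_minor[OF CD])
  show ?thesis
  proof (rule that)
    show "C' \<subseteq> ground M - C - D - ground N" "ground N \<subseteq> ground M - C - D"
      using N'(1) gN gL by auto
    fix X assume X: "X \<subseteq> ground N"
    have "rank N X + rank ?L C' = rank ?L (X \<union> C')"
      unfolding N'(2) using X gN by (intro L.rank_minor[OF N'(1)]) simp
    moreover have "rank ?L C' + rank M C = rank M (C' \<union> C)"
      using N'(1) gL by (intro rank_minor[OF CD]) simp
    moreover have "rank ?L (X \<union> C') + rank M C = rank M (X \<union> C' \<union> C)"
      using N'(1) gL X gN by (intro rank_minor[OF CD]) auto
    ultimately show "rank N X + rank M (C' \<union> C) = rank M (X \<union> (C' \<union> C))"
      by (simp add: Un_assoc)
  qed
qed

text \<open>The nullity of \<open>X \<inter> A\<close> is at most that of \<open>A\<close>. In this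
  form the nullities in the lower bound on \<open>k\<close> control intersections with
  \<open>A\<^sub>1\<close> and \<open>A\<^sub>2\<close>.\<close>

lemma card_Int_le_rank_nullity:
  assumes "A \<subseteq> ground M"
  shows "card (X \<inter> A) \<le> rank M X + nullity M A"
proof -
  have finA: "finite A" using assms finite_ground finite_subset by blast
  have "A - X \<inter> A = A - X" by auto
  then have "rank M A \<le> rank M (X \<inter> A) + card (A - X)"
    using rank_le_diff[OF finA, of "X \<inter> A"] by simp
  moreover have "card A = card (X \<inter> A) + card (A - X)"
    using finA card_Int_Diff[of A X] by (simp add: Int_commute)
  moreover have "rank M (X \<inter> A) \<le> rank M X" by (intro rank_mono) auto
  moreover have "rank M A \<le> card A" using rank_le_card finA .
  ultimately show ?thesis unfolding nullity_def by linarith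
qed

end

subsection \<open>The amalgam of two matroids\<close>

text \<open>\<open>A\<close> comes from the other matroid: flats of \<open>N\<^sub>1\<close> are
  lifted with \<open>A\<^sub>2\<close>, flats of \<open>N\<^sub>2\<close> with
  \<open>A\<^sub>1\<close>.\<close>

definition lifted_flats :: "'a indep_system \<Rightarrow> 'a set \<Rightarrow> 'a set \<Rightarrow> ('a set \<times> nat) set" where
  "lifted_flats N U A =
     {(F \<union> U \<union> A, rank N F + card U + card A) | F. F \<in> proper_cyclic_flats N}"

text \<open>Sizes are fixed by sums to avoid natural-number subtraction. Nonuniformity is assumed
  here because the existence proof for the matroid uses it.\<close>

locale amalgam =
  fixes N\<^sub>1 :: "'a indep_system" and A\<^sub>1 U\<^sub>1 :: "'a set"
    and N\<^sub>2 :: "'a indep_system" and A\<^sub>2 U\<^sub>2 :: "'a set" and k :: nat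
  assumes matroid1: "matroid N\<^sub>1" and matroid2: "matroid N\<^sub>2"
    and pos1: "rank N\<^sub>1 (ground N\<^sub>1) > 0" and pos2: "rank N\<^sub>2 (ground N\<^sub>2) > 0"
    and disjoint: "ground N\<^sub>1 \<inter> ground N\<^sub>2 = {}"
    and A1: "A\<^sub>1 \<subseteq> ground N\<^sub>1" and A2: "A\<^sub>2 \<subseteq> ground N\<^sub>2"
    and bound: "rank N\<^sub>1 (ground N\<^sub>1) + nullity N\<^sub>1 A\<^sub>1 + rank N\<^sub>2 (ground N\<^sub>2) + nullity N\<^sub>2 A\<^sub>2 \<le> k"
    and finU1: "finite U\<^sub>1" and finU2: "finite U\<^sub>2"
    and card1: "rank N\<^sub>1 (ground N\<^sub>1) + card U\<^sub>1 + card A\<^sub>2 = k"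
    and card2: "rank N\<^sub>2 (ground N\<^sub>2) + card U\<^sub>2 + card A\<^sub>1 = k"
    and U: "U\<^sub>1 \<inter> U\<^sub>2 = {}"
    and U1: "U\<^sub>1 \<inter> (ground N\<^sub>1 \<union> ground N\<^sub>2) = {}" and U2: "U\<^sub>2 \<inter> (ground N\<^sub>1 \<union> ground N\<^sub>2) = {}"
    and nonuniform1: "\<not> uniform N\<^sub>1" and nonuniform2: "\<not> uniform N\<^sub>2"
begin

sublocale N1: matroid N\<^sub>1 by (rule matroid1)
sublocale N2: matroid N\<^sub>2 by (rule matroid2)

text \<open>The hypotheses are symmetric, so results proved for the first side transfer to the
  second.\<close>

lemma swap: "amalgam N\<^sub>2 A\<^sub>2 U\<^sub>2 N\<^sub>1 A\<^sub>1 U\<^sub>1 k"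
  using matroid1 matroid2 pos1 pos2 disjoint A1 A2 bound finU1 finU2 card1 card2 U U1 U2
    nonuniform1 nonuniform2
  by (intro amalgam.intro) (assumption | linarith | blast)+

section \<open>The ranked family of the amalgam and its axioms\<close>

definition E :: "'a set" where
  "E = ground N\<^sub>1 \<union> ground N\<^sub>2 \<union> U\<^sub>1 \<union> U\<^sub>2"

definition family :: "('a set \<times> nat) set" where
  "family = {({}, 0), (E, k)} \<union> lifted_flats N\<^sub>1 U\<^sub>1 A\<^sub>2 \<union> lifted_flats N\<^sub>2 U\<^sub>2 A\<^sub>1"

lemma swap_E: "amalgam.E N\<^sub>2 U\<^sub>2 N\<^sub>1 U\<^sub>1 = E"
  unfolding amalgam.E_def[OF swap] E_def by auto

lemma finite_E: "finite E"
  unfolding E_def using N1.finite_ground N2.finite_ground finU1 finU2 by simp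

lemma finite_A: "finite A\<^sub>1" "finite A\<^sub>2"
  using A1 A2 N1.finite_ground N2.finite_ground finite_subset by auto

lemma family_cases:
  assumes "(Z, n) \<in> family"
  obtains "Z = {}" "n = 0" | "Z = E" "n = k"
  | F where "F \<in> proper_cyclic_flats N\<^sub>1" "Z = F \<union> U\<^sub>1 \<union> A\<^sub>2" "n = rank N\<^sub>1 F + card U\<^sub>1 + card A\<^sub>2"
  | G where "G \<in> proper_cyclic_flats N\<^sub>2" "Z = G \<union> U\<^sub>2 \<union> A\<^sub>1" "n = rank N\<^sub>2 G + card U\<^sub>2 + card A\<^sub>1"
  using assms unfolding family_def lifted_flats_def by auto

lemma familyI:
  "({}, 0) \<in> family" "(E, k) \<in> family"
  "F \<in> proper_cyclic_flats N\<^sub>1 \<Longrightarrow> (F \<union> U\<^sub>1 \<union> A\<^sub>2, rank N\<^sub>1 F + card U\<^sub>1 + card A\<^sub>2) \<in> family"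
  "G \<in> proper_cyclic_flats N\<^sub>2 \<Longrightarrow> (G \<union> U\<^sub>2 \<union> A\<^sub>1, rank N\<^sub>2 G + card U\<^sub>2 + card A\<^sub>1) \<in> family"
  unfolding family_def lifted_flats_def by auto

lemma proper1D:
  assumes "F \<in> proper_cyclic_flats N\<^sub>1"
  shows "cyclic_flat N\<^sub>1 F" "F \<subseteq> ground N\<^sub>1" "finite F" "F \<noteq> {}" "\<not> ground N\<^sub>1 \<subseteq> F"
    "rank N\<^sub>1 F < rank N\<^sub>1 (ground N\<^sub>1)" "rank N\<^sub>1 F < card F"
proof -
  show cf: "cyclic_flat N\<^sub>1 F" "F \<noteq> {}" and sub: "F \<subseteq> ground N\<^sub>1" and "finite F"
    and np: "\<not> ground N\<^sub>1 \<subseteq> F"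
    using assms N1.cyclic_flatD(1,2) unfolding proper_cyclic_flats_def by auto
  show "rank N\<^sub>1 F < rank N\<^sub>1 (ground N\<^sub>1)"
    using N1.flat_rank_less[OF cf(1) order_refl np] sub by (simp add: Un_absorb1)
  show "rank N\<^sub>1 F < card F"
    using N1.cyclic_rank_less[OF cf(1), of "{}"] cf(2) N1.rank_empty by simp
qed

lemmas proper2D = amalgam.proper1D[OF swap]

lemma lifted_set:
  assumes "F \<subseteq> ground N\<^sub>1"
  shows "(F \<union> U\<^sub>1 \<union> A\<^sub>2) \<inter> ground N\<^sub>1 = F" "F \<union> U\<^sub>1 \<union> A\<^sub>2 \<subseteq> E"
    "X \<subseteq> ground N\<^sub>1 \<Longrightarrow> (F \<union> U\<^sub>1 \<union> A\<^sub>2) - (X \<union> U\<^sub>1 \<union> A\<^sub>2) = F - X"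
    "card (F \<union> U\<^sub>1 \<union> A\<^sub>2) = card F + card U\<^sub>1 + card A\<^sub>2"
proof -
  show "(F \<union> U\<^sub>1 \<union> A\<^sub>2) \<inter> ground N\<^sub>1 = F" "F \<union> U\<^sub>1 \<union> A\<^sub>2 \<subseteq> E"
    "X \<subseteq> ground N\<^sub>1 \<Longrightarrow> (F \<union> U\<^sub>1 \<union> A\<^sub>2) - (X \<union> U\<^sub>1 \<union> A\<^sub>2) = F - X"
    using assms A2 U1 disjoint unfolding E_def by auto
  have "finite F" using assms N1.finite_ground finite_subset by blast
  moreover have "F \<inter> U\<^sub>1 = {}" "(F \<union> U\<^sub>1) \<inter> A\<^sub>2 = {}" using assms A2 U1 disjoint by auto
  ultimately show "card (F \<union> U\<^sub>1 \<union> A\<^sub>2) = card F + card U\<^sub>1 + card A\<^sub>2"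
    using finU1 finite_A by (simp add: card_Un_disjoint)
qed

text \<open>Containment forces \<open>U\<^sub>1 = {}\<close> and
  \<open>A\<^sub>2 \<subseteq> G\<close>. The size condition then makes
  \<open>card A\<^sub>2\<close> at least the full rank of \<open>N\<^sub>2\<close> plus the nullity
  of \<open>A\<^sub>2\<close>, too much for a subset of the nonspanning \<open>G\<close>.\<close>

lemma lifted_incomparable:
  assumes F: "F \<in> proper_cyclic_flats N\<^sub>1" and G: "G \<in> proper_cyclic_flats N\<^sub>2"
  shows "\<not> F \<union> U\<^sub>1 \<union> A\<^sub>2 \<subseteq> G \<union> U\<^sub>2 \<union> A\<^sub>1"
proof
  assume sub: "F \<union> U\<^sub>1 \<union> A\<^sub>2 \<subseteq> G \<union> U\<^sub>2 \<union> A\<^sub>1"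
  have "U\<^sub>1 = {}" using sub U U1 A1 proper2D(2)[OF G] by blast
  then have "card A\<^sub>2 \<ge> rank N\<^sub>2 (ground N\<^sub>2) + nullity N\<^sub>2 A\<^sub>2" using card1 bound by simp
  moreover have "A\<^sub>2 \<subseteq> G" using sub A1 A2 disjoint U2 by blast
  then have "card A\<^sub>2 \<le> rank N\<^sub>2 G + nullity N\<^sub>2 A\<^sub>2"
    using N2.card_Int_le_rank_nullity[OF A2, of G] by (simp add: Int_absorb1)
  ultimately show False using proper2D(6)[OF G] by simp
qed

text \<open>Otherwise the bound on \<open>k\<close> would make the whole ground set of
  \<open>N\<^sub>2\<close> independent, leaving no proper cyclic flat. The gap makes the nullity of
  \<open>E\<close> strictly exceed that of each lifted flat of \<open>N\<^sub>1\<close>.\<close>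

lemma spanning_gap: "ground N\<^sub>2 \<noteq> A\<^sub>2 \<or> U\<^sub>2 \<noteq> {}"
proof (rule ccontr)
  assume "\<not> ?thesis"
  then have eq: "A\<^sub>2 = ground N\<^sub>2" "U\<^sub>2 = {}" by auto
  have "card A\<^sub>1 \<le> rank N\<^sub>1 (ground N\<^sub>1) + nullity N\<^sub>1 A\<^sub>1"
    using N1.card_Int_le_rank_nullity[OF A1, of "ground N\<^sub>1"] A1 by (simp add: Int_absorb1)
  then have "nullity N\<^sub>2 A\<^sub>2 = 0" using card2 bound eq(2) by simp
  then have "card (G \<inter> A\<^sub>2) \<le> rank N\<^sub>2 G" for G
    using N2.card_Int_le_rank_nullity[OF A2, of G] by simp
  then have "G \<notin> proper_cyclic_flats N\<^sub>2" for G
    using proper2D(2,7)[of G] eq(1) by (metis Int_absorb2 not_le)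
  then show False using N2.uniformI nonuniform2 by blast
qed

lemma lifted_bounds:
  assumes F: "F \<in> proper_cyclic_flats N\<^sub>1"
  defines "Z \<equiv> F \<union> U\<^sub>1 \<union> A\<^sub>2" and "n \<equiv> rank N\<^sub>1 F + card U\<^sub>1 + card A\<^sub>2"
  shows "0 < n" "n < card Z" "n < k" "k < n + card (E - Z)"
proof -
  \<comment> \<open>By \<open>card1\<close> and \<open>bound\<close>,
    \<open>card U\<^sub>1 + card A\<^sub>2\<close> is at least the positive rank of
    \<open>N\<^sub>2\<close>.\<close>
  show "0 < n" unfolding n_def using card1 bound pos2 by linarith
  show "n < card Z" unfolding n_def Z_def using lifted_set(4)[OF proper1D(2)[OF F]] proper1D(7)[OF F] by simp
  show "n < k" unfolding n_def using proper1D(6)[OF F] card1 by simp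
  have "rank N\<^sub>1 (ground N\<^sub>1) \<le> rank N\<^sub>1 F + card (ground N\<^sub>1 - F)"
    using N1.finite_ground by (rule N1.rank_le_diff)
  moreover have "ground N\<^sub>1 - F \<subset> E - Z"
  proof
    show "ground N\<^sub>1 - F \<subseteq> E - Z" unfolding E_def Z_def using A2 U1 disjoint by auto
    \<comment> \<open>This point outside both \<open>Z\<close> and \<open>ground N\<^sub>1\<close>
      supplies the strictness.\<close>
    obtain x where "x \<in> ground N\<^sub>2 - A\<^sub>2 \<or> x \<in> U\<^sub>2" using spanning_gap A2 by blast
    then have "x \<in> E - Z" "x \<notin> ground N\<^sub>1"
      unfolding E_def Z_def using proper1D(2)[OF F] U U1 U2 A2 disjoint by auto
    then show "ground N\<^sub>1 - F \<noteq> E - Z" by blast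
  qed
  then have "card (ground N\<^sub>1 - F) < card (E - Z)" using finite_E by (intro psubset_card_mono) auto
  ultimately show "k < n + card (E - Z)" unfolding n_def using card1 by simp
qed

lemma lifted_strict:
  assumes F: "F \<in> proper_cyclic_flats N\<^sub>1" and G: "G \<in> proper_cyclic_flats N\<^sub>1"
    and "F \<union> U\<^sub>1 \<union> A\<^sub>2 \<subset> G \<union> U\<^sub>1 \<union> A\<^sub>2"
  shows "rank N\<^sub>1 F < rank N\<^sub>1 G" "rank N\<^sub>1 G < rank N\<^sub>1 F + card ((G \<union> U\<^sub>1 \<union> A\<^sub>2) - (F \<union> U\<^sub>1 \<union> A\<^sub>2))"
proof -
  have FG: "F \<subseteq> G" "\<not> G \<subseteq> F"
    using assms(3) lifted_set(1)[OF proper1D(2)[OF F]] lifted_set(1)[OF proper1D(2)[OF G]] by blast+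
  show "rank N\<^sub>1 F < rank N\<^sub>1 G"
    using N1.flat_rank_less[OF proper1D(1)[OF F] proper1D(2)[OF G] FG(2)] FG(1)
    by (simp add: Un_absorb1)
  show "rank N\<^sub>1 G < rank N\<^sub>1 F + card ((G \<union> U\<^sub>1 \<union> A\<^sub>2) - (F \<union> U\<^sub>1 \<union> A\<^sub>2))"
    using N1.cyclic_rank_less[OF proper1D(1)[OF G] FG(2)]
    unfolding lifted_set(3)[OF proper1D(2)[OF G] proper1D(2)[OF F]] .
qed

text \<open>Lift the join and the cyclic part of the intersection from \<open>N\<^sub>1\<close>,
  replacing a full join by \<open>E\<close> and an empty meet by \<open>{}\<close>. By
  \<open>card1\<close> the values match in all cases, so submodularity in \<open>N\<^sub>1\<close>
  suffices.\<close>

lemma lifted_join_meet: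
  assumes F: "F \<in> proper_cyclic_flats N\<^sub>1" and G: "G \<in> proper_cyclic_flats N\<^sub>1"
  defines "Y \<equiv> F \<union> U\<^sub>1 \<union> A\<^sub>2" and "Z \<equiv> G \<union> U\<^sub>1 \<union> A\<^sub>2"
  shows "\<exists>J j W w. (J, j) \<in> family \<and> (W, w) \<in> family \<and> Y \<union> Z \<subseteq> J \<and> W \<subseteq> Y \<inter> Z \<and>
    j + w + card (Y \<inter> Z - W) \<le>
      (rank N\<^sub>1 F + card U\<^sub>1 + card A\<^sub>2) + (rank N\<^sub>1 G + card U\<^sub>1 + card A\<^sub>2)"
proof -
  note FD = proper1D[OF F] and GD = proper1D[OF G]
  have YZ: "Y \<inter> Z = (F \<inter> G) \<union> U\<^sub>1 \<union> A\<^sub>2"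
    unfolding Y_def Z_def using FD(2) GD(2) U1 A2 disjoint by auto
  have FG: "F \<inter> G \<subseteq> ground N\<^sub>1" using FD(2) by blast
  have "\<exists>J j. (J, j) \<in> family \<and> Y \<union> Z \<subseteq> J \<and> j = rank N\<^sub>1 (F \<union> G) + card U\<^sub>1 + card A\<^sub>2"
  proof -
    obtain J where J: "cyclic_flat N\<^sub>1 J" "F \<union> G \<subseteq> J" "rank N\<^sub>1 J = rank N\<^sub>1 (F \<union> G)"
      by (rule N1.cyclic_flats_join[OF FD(1) GD(1)])
    show ?thesis
    proof (cases "J = ground N\<^sub>1")
      case True
      have "Y \<union> Z \<subseteq> E" unfolding Y_def Z_def using lifted_set(2) FD(2) GD(2) by simp
      then show ?thesis using familyI(2) True J(3) card1 by auto
    next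
      case False
      then have "J \<in> proper_cyclic_flats N\<^sub>1"
        using J FD(4) unfolding proper_cyclic_flats_def by auto
      moreover have "Y \<union> Z \<subseteq> J \<union> U\<^sub>1 \<union> A\<^sub>2" unfolding Y_def Z_def using J(2) by auto
      ultimately show ?thesis using familyI(3)[of J] J(3) by auto
    qed
  qed
  then obtain J j where J: "(J, j) \<in> family" "Y \<union> Z \<subseteq> J"
    "j = rank N\<^sub>1 (F \<union> G) + card U\<^sub>1 + card A\<^sub>2" by blast
  have "\<exists>W w. (W, w) \<in> family \<and> W \<subseteq> Y \<inter> Z \<and>
      w + card (Y \<inter> Z - W) = rank N\<^sub>1 (F \<inter> G) + card U\<^sub>1 + card A\<^sub>2"
  proof -
    let ?W = "N1.cyclic_part (F \<inter> G)"
    have W: "?W \<subseteq> F \<inter> G" by (rule N1.cyclic_part_subset)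
    have r: "rank N\<^sub>1 (F \<inter> G) = rank N\<^sub>1 ?W + card (F \<inter> G - ?W)"
      by (rule N1.rank_cyclic_part[OF FG])
    show ?thesis
    proof (cases "?W = {}")
      case True
      then have "rank N\<^sub>1 (F \<inter> G) = card (F \<inter> G)" using r N1.rank_empty by simp
      then show ?thesis using familyI(1) lifted_set(4)[OF FG] unfolding YZ
        by (intro exI[of _ "{}"] exI[of _ 0]) simp
    next
      case False
      have "?W \<noteq> ground N\<^sub>1" using W FD(5) by blast
      then have "?W \<in> proper_cyclic_flats N\<^sub>1"
        using False N1.cyclic_flat_cyclic_part[OF FD(1) GD(1)]
        unfolding proper_cyclic_flats_def by simp
      moreover have "?W \<union> U\<^sub>1 \<union> A\<^sub>2 \<subseteq> Y \<inter> Z" unfolding YZ using W by auto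
      moreover have "Y \<inter> Z - (?W \<union> U\<^sub>1 \<union> A\<^sub>2) = F \<inter> G - ?W"
        unfolding YZ using W FG by (intro lifted_set(3)) auto
      ultimately show ?thesis using familyI(3)[of ?W] r
        by (intro exI[of _ "?W \<union> U\<^sub>1 \<union> A\<^sub>2"] exI[of _ "rank N\<^sub>1 ?W + card U\<^sub>1 + card A\<^sub>2"]) simp
    qed
  qed
  then obtain W w where W: "(W, w) \<in> family" "W \<subseteq> Y \<inter> Z"
    "w + card (Y \<inter> Z - W) = rank N\<^sub>1 (F \<inter> G) + card U\<^sub>1 + card A\<^sub>2" by blast
  have "j + w + card (Y \<inter> Z - W) \<le>
      (rank N\<^sub>1 F + card U\<^sub>1 + card A\<^sub>2) + (rank N\<^sub>1 G + card U\<^sub>1 + card A\<^sub>2)"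
    using J(3) W(3) N1.rank_submodular[of F G] by linarith
  then show ?thesis using J(1,2) W(1,2) by blast
qed

text \<open>The intersection is
  \<open>(F \<inter> A\<^sub>1) \<union> (G \<inter> A\<^sub>2)\<close>, and each piece is at most
  rank plus nullity. After \<open>card1\<close> and \<open>card2\<close> are added, what remains is
  the lower bound on \<open>k\<close>.\<close>

lemma mixed_join_meet:
  assumes F: "F \<in> proper_cyclic_flats N\<^sub>1" and G: "G \<in> proper_cyclic_flats N\<^sub>2"
  shows "k + card ((F \<union> U\<^sub>1 \<union> A\<^sub>2) \<inter> (G \<union> U\<^sub>2 \<union> A\<^sub>1)) \<le>
    (rank N\<^sub>1 F + card U\<^sub>1 + card A\<^sub>2) + (rank N\<^sub>2 G + card U\<^sub>2 + card A\<^sub>1)"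
proof -
  have "(F \<union> U\<^sub>1 \<union> A\<^sub>2) \<inter> (G \<union> U\<^sub>2 \<union> A\<^sub>1) = (F \<inter> A\<^sub>1) \<union> (G \<inter> A\<^sub>2)"
    using proper1D(2)[OF F] proper2D(2)[OF G] A1 A2 U U1 U2 disjoint by auto
  then have "card ((F \<union> U\<^sub>1 \<union> A\<^sub>2) \<inter> (G \<union> U\<^sub>2 \<union> A\<^sub>1)) \<le> card (F \<inter> A\<^sub>1) + card (G \<inter> A\<^sub>2)"
    using card_Un_le by simp
  then show ?thesis
    using N1.card_Int_le_rank_nullity[OF A1, of F] N2.card_Int_le_rank_nullity[OF A2, of G]
      bound card1 card2 by linarith
qed

lemma swap_family: "amalgam.family N\<^sub>2 A\<^sub>2 U\<^sub>2 N\<^sub>1 A\<^sub>1 U\<^sub>1 k = family"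
  unfolding amalgam.family_def[OF swap] swap_E family_def by auto

lemma cyclic_flat_system: "cyclic_flat_system E family"
proof
  note lifted_set2 = amalgam.lifted_set[OF swap, unfolded swap_E]
  have ne: "F \<union> U\<^sub>1 \<union> A\<^sub>2 \<noteq> {}" "F \<union> U\<^sub>1 \<union> A\<^sub>2 \<noteq> E" if "F \<in> proper_cyclic_flats N\<^sub>1" for F
    using proper1D(2,4,5)[OF that] lifted_set(1)[of F] unfolding E_def by auto
  have ne2: "G \<union> U\<^sub>2 \<union> A\<^sub>1 \<noteq> {}" "G \<union> U\<^sub>2 \<union> A\<^sub>1 \<noteq> E" if "G \<in> proper_cyclic_flats N\<^sub>2" for G
    using proper2D(2,4,5)[OF that] lifted_set2(1)[of G] unfolding E_def by auto
  have E_ne: "E \<noteq> {}" using pos1 N1.rank_empty unfolding E_def by auto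
  have Z_E: "Z \<subseteq> E" if "(Z, n) \<in> family" for Z n
    using that by (cases rule: family_cases) (auto dest: lifted_set(2)[OF proper1D(2)] lifted_set2(2)[OF proper2D(2)])
  show "finite E" by (rule finite_E)
  show "Z \<subseteq> E" if "(Z, n) \<in> family" for Z n using Z_E that .
  show "({}, 0) \<in> family" by (rule familyI)
  show "m = n" if Zm: "(Z, m) \<in> family" and Zn: "(Z, n) \<in> family" for Z m n
    using Zm
  proof (cases rule: family_cases)
    case 1
    show ?thesis using Zn by (cases rule: family_cases) (use 1 ne ne2 E_ne in auto)
  next
    case 2
    show ?thesis using Zn
    proof (cases rule: family_cases)
      case (3 F)
      then show ?thesis using \<open>Z = E\<close> ne(2)[OF 3(1)] by simp
    next
      case (4 F)
      then show ?thesis using \<open>Z = E\<close> ne2(2)[OF 4(1)] by simp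
    qed (use 2 E_ne in auto)
  next
    case (3 F)
    show ?thesis using Zn
    proof (cases rule: family_cases)
      case (3 G)
      then have "F = G"
        using \<open>Z = F \<union> U\<^sub>1 \<union> A\<^sub>2\<close> lifted_set(1)[OF proper1D(2)] \<open>F \<in> proper_cyclic_flats N\<^sub>1\<close> by metis
      then show ?thesis using 3 \<open>m = _\<close> by simp
    next
      case (4 G)
      then show ?thesis using 3 lifted_incomparable[of F G] by simp
    qed (use 3 ne in auto)
  next
    case (4 F)
    show ?thesis using Zn
    proof (cases rule: family_cases)
      case (4 G)
      then have "F = G"
        using \<open>Z = F \<union> U\<^sub>2 \<union> A\<^sub>1\<close> lifted_set2(1)[OF proper2D(2)] \<open>F \<in> proper_cyclic_flats N\<^sub>2\<close> by metis
      then show ?thesis using 4 \<open>m = _\<close> by simp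
    next
      case (3 G)
      then show ?thesis using 4 lifted_incomparable[of G F] by simp
    qed (use 4 ne2 in auto)
  qed
  show "m < n \<and> n < m + card (Z - W)"
    if Wm: "(W, m) \<in> family" and Zn: "(Z, n) \<in> family" and WZ: "W \<subset> Z" for W Z m n
    using Wm
  proof (cases rule: family_cases)
    case 1
    show ?thesis using Zn
    proof (cases rule: family_cases)
      case 2
      \<comment> \<open>The empty set and \<open>E\<close> are compared through an intermediate
        lifted flat, which nonuniformity provides.\<close>
      obtain F where F: "F \<in> proper_cyclic_flats N\<^sub>1" using N1.uniformI nonuniform1 by blast
      have "card (E - (F \<union> U\<^sub>1 \<union> A\<^sub>2)) = card E - card (F \<union> U\<^sub>1 \<union> A\<^sub>2)"
        "card (F \<union> U\<^sub>1 \<union> A\<^sub>2) \<le> card E"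
        using lifted_set(2)[OF proper1D(2)[OF F]] finite_E
        by (auto intro!: card_Diff_subset card_mono intro: finite_subset)
      then show ?thesis using lifted_bounds[OF F] 1 2 by simp
    qed (use 1 WZ lifted_bounds amalgam.lifted_bounds[OF swap] in auto)
  next
    case 2
    then show ?thesis using WZ Z_E[OF Zn] by blast
  next
    case (3 F)
    show ?thesis using Zn
    proof (cases rule: family_cases)
      case (3 G)
      then show ?thesis
        using lifted_strict[of F G] \<open>W = _\<close> \<open>m = _\<close> \<open>F \<in> _\<close> WZ by simp
    next
      case (4 G)
      then show ?thesis using 3 WZ lifted_incomparable[of F G] by auto
    qed (use 3 WZ lifted_bounds[of F] in auto)
  next
    case (4 F)
    show ?thesis using Zn
    proof (cases rule: family_cases)
      case (4 G)
      then show ?thesis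
        using amalgam.lifted_strict[OF swap, of F G] \<open>W = _\<close> \<open>m = _\<close> \<open>F \<in> _\<close> WZ by simp
    next
      case (3 G)
      then show ?thesis using 4 WZ amalgam.lifted_incomparable[OF swap, of F G] by auto
    qed (use 4 WZ amalgam.lifted_bounds[OF swap, unfolded swap_E, of F] in auto)
  qed
  show "\<exists>J j W w. (J, j) \<in> family \<and> (W, w) \<in> family \<and> Y \<union> Z \<subseteq> J \<and> W \<subseteq> Y \<inter> Z \<and>
        j + w + card (Y \<inter> Z - W) \<le> m + n"
    if Ym: "(Y, m) \<in> family" and Zn: "(Z, n) \<in> family" for Y Z m n
  proof -
    have nested: ?thesis if "Y \<subseteq> Z"
    proof -
      have "Y \<inter> Z - Y = {}" by auto
      then have "n + m + card (Y \<inter> Z - Y) \<le> m + n" by (simp only: card.empty)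
      moreover have "Y \<union> Z \<subseteq> Z" "Y \<subseteq> Y \<inter> Z" using that by auto
      ultimately show ?thesis using Ym Zn by blast
    qed
    have nested': ?thesis if "Z \<subseteq> Y"
    proof -
      have "Y \<inter> Z - Z = {}" by auto
      then have "m + n + card (Y \<inter> Z - Z) \<le> m + n" by (simp only: card.empty)
      moreover have "Y \<union> Z \<subseteq> Y" "Z \<subseteq> Y \<inter> Z" using that by auto
      ultimately show ?thesis using Ym Zn by blast
    qed
    \<comment> \<open>For lifted flats of different sides: join \<open>E\<close>, meet
      \<open>{}\<close>.\<close>
    have mixed: ?thesis if "k + card (Y \<inter> Z) \<le> m + n"
    proof -
      have "k + 0 + card (Y \<inter> Z - {}) \<le> m + n" using that by simp
      moreover have "Y \<union> Z \<subseteq> E" using Z_E[OF Ym] Z_E[OF Zn] by simp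
      ultimately show ?thesis using familyI(1,2) by blast
    qed
    show ?thesis using Ym
    proof (cases rule: family_cases)
      case 1
      then show ?thesis using nested by simp
    next
      case 2
      then show ?thesis using nested' Z_E[OF Zn] by simp
    next
      case (3 F)
      show ?thesis using Zn
      proof (cases rule: family_cases)
        case 1
        then show ?thesis using nested' by simp
      next
        case 2
        then show ?thesis using nested Z_E[OF Ym] by simp
      next
        case (3 G)
        then show ?thesis
          using lifted_join_meet[of F G] \<open>Y = _\<close> \<open>m = _\<close> \<open>F \<in> _\<close> by simp
      next
        case (4 G)
        then show ?thesis
          using mixed mixed_join_meet[of F G] 3 by simp
      qed
    next
      case (4 F)
      show ?thesis using Zn
      proof (cases rule: family_cases)
        case 1
        then show ?thesis using nested' by simp
      next
        case 2
        then show ?thesis using nested Z_E[OF Ym] by simp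
      next
        case (4 G)
        then show ?thesis
          using amalgam.lifted_join_meet[OF swap, of F G] \<open>Y = _\<close> \<open>m = _\<close> \<open>F \<in> _\<close>
          unfolding swap_family by simp
      next
        case (3 G)
        then show ?thesis
          using mixed mixed_join_meet[of G F] 4 by (simp add: Int_commute add.commute)
      qed
    qed
  qed
qed

section \<open>The amalgam as a matroid and its rank function\<close>

definition M :: "'a indep_system" where
  "M = M_k k N\<^sub>1 A\<^sub>1 U\<^sub>1 N\<^sub>2 A\<^sub>2 U\<^sub>2"

text \<open>The description in \<open>M_k\<close> is justified: \<open>rank_matroid\<close> of the
  family gives existence, and \<open>matroid_eqI_cyclic_flats\<close> gives uniqueness.\<close>

lemma M_spec: "matroid M \<and> ground M = E \<and> {(Y, rank M Y) | Y. cyclic_flat M Y} = family"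
proof -
  interpret P: cyclic_flat_system E family by (rule cyclic_flat_system)
  have "M = (THE M. matroid M \<and> ground M = E \<and> {(Y, rank M Y) | Y. cyclic_flat M Y} = family)"
    unfolding M_def M_k_def Let_def E_def family_def lifted_flats_def ..
  moreover have "\<exists>!M. matroid M \<and> ground M = E \<and> {(Y, rank M Y) | Y. cyclic_flat M Y} = family"
  proof (rule ex1I)
    show "matroid P.rank_matroid \<and> ground P.rank_matroid = E \<and>
        {(Y, rank P.rank_matroid Y) | Y. cyclic_flat P.rank_matroid Y} = family"
      using P.matroid_rank_matroid P.cyclic_flats_rank_matroid by simp
    then show "N = P.rank_matroid"
      if "matroid N \<and> ground N = E \<and> {(Y, rank N Y) | Y. cyclic_flat N Y} = family" for N
      using that by (intro matroid_eqI_cyclic_flats) simp_all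
  qed
  ultimately show ?thesis using theI' by simp
qed

lemma ground_M: "ground M = E"
  using M_spec by simp

sublocale M: matroid M
  using M_spec by simp

lemma swap_M: "amalgam.M N\<^sub>2 A\<^sub>2 U\<^sub>2 N\<^sub>1 A\<^sub>1 U\<^sub>1 k = M"
proof (rule matroid_eqI_cyclic_flats)
  note M' = amalgam.M_spec[OF swap, unfolded swap_E swap_family]
  show "matroid (amalgam.M N\<^sub>2 A\<^sub>2 U\<^sub>2 N\<^sub>1 A\<^sub>1 U\<^sub>1 k)" "matroid M"
    "ground (amalgam.M N\<^sub>2 A\<^sub>2 U\<^sub>2 N\<^sub>1 A\<^sub>1 U\<^sub>1 k) = ground M"
    using M' M_spec by simp_all
  show "{(Y, rank (amalgam.M N\<^sub>2 A\<^sub>2 U\<^sub>2 N\<^sub>1 A\<^sub>1 U\<^sub>1 k) Y) | Y. cyclic_flat (amalgam.M N\<^sub>2 A\<^sub>2 U\<^sub>2 N\<^sub>1 A\<^sub>1 U\<^sub>1 k) Y}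
      = {(Y, rank M Y) | Y. cyclic_flat M Y}"
    using M' M_spec by simp
qed

lemma rank_M_le:
  assumes "(Z, n) \<in> family" "X \<subseteq> E"
  shows "rank M X \<le> n + card (X - Z)"
proof -
  have "(Z, n) \<in> {(Y, rank M Y) | Y. cyclic_flat M Y}" using assms(1) M_spec by simp
  then have "rank M Z = n" by auto
  then show ?thesis using M.rank_le_diff[of X Z] assms(2) finite_E finite_subset by blast
qed

lemma rank_M_attained:
  assumes "X \<subseteq> E"
  obtains Z n where "(Z, n) \<in> family" "rank M X = n + card (X - Z)"
proof -
  obtain Z where Z: "cyclic_flat M Z" "rank M X = rank M Z + card (X - Z)"
    using M.rank_by_cyclic_flat[of X] assms ground_M by auto
  then have "(Z, rank M Z) \<in> {(Y, rank M Y) | Y. cyclic_flat M Y}" by blast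
  then have "(Z, rank M Z) \<in> family" using M_spec by simp
  then show ?thesis using that Z(2) by simp
qed

text \<open>The terms of \<open>{}\<close>, \<open>E\<close> and the lifted flats of
  \<open>N\<^sub>1\<close> reproduce the rank formula of \<open>N\<^sub>1\<close> shifted by a
  constant, with \<open>E\<close> in the role of \<open>ground N\<^sub>1\<close>. Terms from
  \<open>N\<^sub>2\<close> are never smaller than the claimed rank.\<close>

lemma rank_M_lift:
  assumes X: "X \<subseteq> ground N\<^sub>1"
  shows "rank M (X \<union> U\<^sub>1 \<union> A\<^sub>2) = rank N\<^sub>1 X + card U\<^sub>1 + card A\<^sub>2"
proof (rule antisym)
  have XE: "X \<union> U\<^sub>1 \<union> A\<^sub>2 \<subseteq> E" using lifted_set(2)[OF X] .
  have finX: "finite X" using X N1.finite_ground finite_subset by blast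
  note XZ = lifted_set(3)[OF X]
  show "rank M (X \<union> U\<^sub>1 \<union> A\<^sub>2) \<le> rank N\<^sub>1 X + card U\<^sub>1 + card A\<^sub>2"
  proof -
    obtain Z where Z: "cyclic_flat N\<^sub>1 Z" "rank N\<^sub>1 X = rank N\<^sub>1 Z + card (X - Z)"
      by (rule N1.rank_by_cyclic_flat[OF X])
    consider "Z = {}" | "Z = ground N\<^sub>1" | "Z \<in> proper_cyclic_flats N\<^sub>1"
      using Z(1) unfolding proper_cyclic_flats_def by blast
    then show ?thesis
    proof cases
      case 1
      then show ?thesis
        using Z(2) rank_M_le[OF familyI(1) XE] lifted_set(4)[OF X] N1.rank_empty by simp
    next
      case 2
      then have "X - Z = {}" "X \<union> U\<^sub>1 \<union> A\<^sub>2 - E = {}" using X XE by auto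
      then have "rank N\<^sub>1 X = rank N\<^sub>1 (ground N\<^sub>1)" "card (X \<union> U\<^sub>1 \<union> A\<^sub>2 - E) = 0"
        using Z(2) 2 by (simp_all only: card.empty)
      then show ?thesis using rank_M_le[OF familyI(2) XE] card1 by simp
    next
      case 3
      then show ?thesis
        using rank_M_le[OF familyI(3)[OF 3] XE] XZ[OF proper1D(2)[OF 3]] Z(2) by simp
    qed
  qed
  obtain Z n where Z: "(Z, n) \<in> family"
    "rank M (X \<union> U\<^sub>1 \<union> A\<^sub>2) = n + card (X \<union> U\<^sub>1 \<union> A\<^sub>2 - Z)"
    by (rule rank_M_attained[OF XE])
  have Xr: "rank N\<^sub>1 X \<le> rank N\<^sub>1 (ground N\<^sub>1)" using X by (rule N1.rank_mono)
  show "rank N\<^sub>1 X + card U\<^sub>1 + card A\<^sub>2 \<le> rank M (X \<union> U\<^sub>1 \<union> A\<^sub>2)"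
    using Z(1)
  proof (cases rule: family_cases)
    case 1
    then show ?thesis using Z(2) lifted_set(4)[OF X] N1.rank_le_card[OF finX] by simp
  next
    case 2
    then show ?thesis using Z(2) Xr card1 by simp
  next
    case (3 F)
    then show ?thesis
      using Z(2) XZ[OF proper1D(2)[OF 3(1)]] N1.rank_le_diff[OF finX, of F] by simp
  next
    case (4 G)
    \<comment> \<open>\<open>U\<^sub>1\<close> and \<open>A\<^sub>2 - G\<close> lie outside
      \<open>Z\<close>; counting them, the bound on \<open>k\<close> lifts this term to at least the
      full rank of \<open>N\<^sub>1\<close> plus
      \<open>card U\<^sub>1 + card A\<^sub>2\<close>.\<close>
    have "card (U\<^sub>1 \<union> (A\<^sub>2 - G)) = card U\<^sub>1 + card (A\<^sub>2 - G)"
      using finU1 finite_A A2 U1 by (intro card_Un_disjoint) auto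
    moreover have "U\<^sub>1 \<union> (A\<^sub>2 - G) \<subseteq> X \<union> U\<^sub>1 \<union> A\<^sub>2 - Z"
      using 4(2) proper2D(2)[OF 4(1)] A1 A2 U U1 U2 disjoint by auto
    then have "card (U\<^sub>1 \<union> (A\<^sub>2 - G)) \<le> card (X \<union> U\<^sub>1 \<union> A\<^sub>2 - Z)"
      using finX finU1 finite_A by (intro card_mono) auto
    moreover have "card A\<^sub>2 = card (G \<inter> A\<^sub>2) + card (A\<^sub>2 - G)"
      using card_Int_Diff[OF finite_A(2), of G] by (simp add: Int_commute)
    ultimately show ?thesis
      using Z(2) 4(3) N2.card_Int_le_rank_nullity[OF A2, of G] Xr bound card2 by linarith
  qed
qed

section \<open>How \<open>N\<^sub>1\<close> arises as a minor of the amalgam\<close>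

lemma minor_N1: "minor_of N\<^sub>1 M"
proof -
  let ?C = "U\<^sub>1 \<union> A\<^sub>2" and ?D = "E - ground N\<^sub>1 - (U\<^sub>1 \<union> A\<^sub>2)"
  have "ground N\<^sub>1 = ground M - ?C - ?D" using ground_M A2 U1 disjoint unfolding E_def by auto
  then have "N\<^sub>1 = delete (contract M ?C) ?D"
    using rank_M_lift rank_M_lift[of "{}"] N1.rank_empty
    by (intro M.minor_eqI[OF matroid1]) (simp_all add: Un_assoc)
  moreover have "?C \<subseteq> ground M" "?D \<subseteq> ground M" "?C \<inter> ?D = {}"
    using ground_M A2 unfolding E_def by auto
  ultimately show ?thesis unfolding minor_of_def by blast
qed

text \<open>A cyclic flat \<open>F \<noteq> A\<^sub>1\<close> of \<open>N\<^sub>1\<close> determines the contracted set: in the rank formula for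
  \<open>F \<union> C\<close> only the terms of the lifted flats of \<open>N\<^sub>1\<close> can be tight, and these force
  \<open>C \<subseteq> U\<^sub>1 \<union> A\<^sub>2\<close>.\<close>

lemma contracted_set_unique:
  assumes F: "F \<in> proper_cyclic_flats N\<^sub>1" "F \<noteq> A\<^sub>1"
    and C: "C \<subseteq> E - ground N\<^sub>1"
    and rank: "\<And>X. X \<subseteq> ground N\<^sub>1 \<Longrightarrow> rank N\<^sub>1 X + rank M C = rank M (X \<union> C)"
  shows "C = U\<^sub>1 \<union> A\<^sub>2"
proof -
  note FD = proper1D[OF F(1)]
  have CE: "X \<union> C \<subseteq> E" if "X \<subseteq> ground N\<^sub>1" for X using C that unfolding E_def by auto
  have finC: "finite C" using C finite_E finite_subset by blast
  \<comment> \<open>\<open>F\<close> is cyclic in \<open>N\<^sub>1\<close>, so dropping a point of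
    \<open>F\<close> cannot lower the rank of \<open>F \<union> C\<close>. A tight term that counts
    such a point is thereby excluded.\<close>
  have not_shrinking: False if "x \<in> F" "rank M (F - {x} \<union> C) < rank M (F \<union> C)" for x
    using rank[of F] rank[of "F - {x}"] FD(2) N1.cyclic_flatD(3)[OF FD(1) that(1)] that(2) by auto
  have top: "rank N\<^sub>1 (ground N\<^sub>1) + rank M C \<le> k"
  proof -
    have "ground N\<^sub>1 \<union> C - E = {}" using CE[OF order_refl] by blast
    then have "card (ground N\<^sub>1 \<union> C - E) = 0" by (simp only: card.empty)
    then show ?thesis
      using rank[OF order_refl] rank_M_le[OF familyI(2) CE[OF order_refl]] by simp
  qed
  obtain Z n where Z: "(Z, n) \<in> family" "rank M (F \<union> C) = n + card (F \<union> C - Z)"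
    by (rule rank_M_attained[OF CE[OF FD(2)]])
  show ?thesis using Z(1)
  proof (cases rule: family_cases)
    case 1
    obtain x where x: "x \<in> F" using FD(4) by blast
    have "F - {x} \<union> C \<subset> F \<union> C" using x C FD(2) by auto
    then have "card (F - {x} \<union> C) < card (F \<union> C)"
      using FD(3) finC by (intro psubset_card_mono) auto
    moreover have "rank M (F - {x} \<union> C) \<le> card (F - {x} \<union> C)"
      using FD(3) finC by (intro M.rank_le_card) auto
    ultimately show ?thesis using not_shrinking[OF x] Z(2) 1 by simp
  next
    case 2
    have "rank M (F \<union> C) \<ge> k" using Z(2) 2 by simp
    then show ?thesis using top rank[OF FD(2)] FD(6) by simp
  next
    case (4 G)
    \<comment> \<open>As \<open>A\<^sub>1 \<subseteq> Z\<close>, adding \<open>A\<^sub>1\<close> to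
      \<open>F\<close> does not raise the rank, so the flat \<open>F\<close> contains
      \<open>A\<^sub>1\<close>. Since \<open>F \<noteq> A\<^sub>1\<close>, some point of
      \<open>F\<close> is outside \<open>A\<^sub>1\<close>, hence outside \<open>Z\<close>.\<close>
    have "F \<union> C - Z = F \<union> A\<^sub>1 \<union> C - Z" using 4(2) by auto
    then have "rank N\<^sub>1 (F \<union> A\<^sub>1) \<le> rank N\<^sub>1 F"
      using rank_M_le[OF Z(1) CE, of "F \<union> A\<^sub>1"] Z(2) rank[of F] rank[of "F \<union> A\<^sub>1"] FD(2) A1
      by simp
    then have "A\<^sub>1 \<subseteq> F" using N1.flat_rank_less[OF FD(1) A1] by linarith
    then obtain x where x: "x \<in> F" "x \<notin> A\<^sub>1" using F(2) by blast
    have "x \<notin> Z" using 4 x FD(2) proper2D(2)[OF 4(1)] U2 disjoint by auto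
    then have "F - {x} \<union> C - Z \<subset> F \<union> C - Z" using x C FD(2) by auto
    then have "card (F - {x} \<union> C - Z) < card (F \<union> C - Z)"
      using FD(3) finC by (intro psubset_card_mono) auto
    moreover have "rank M (F - {x} \<union> C) \<le> n + card (F - {x} \<union> C - Z)"
      using FD(2) by (intro rank_M_le[OF Z(1)] CE) auto
    ultimately show ?thesis using not_shrinking[OF x(1)] Z(2) by simp
  next
    case (3 G)
    have "F \<union> C - Z = (F - G) \<union> (C - (U\<^sub>1 \<union> A\<^sub>2))"
      using 3(2) FD(2) proper1D(2)[OF 3(1)] C A2 U1 disjoint by auto
    moreover have "card ((F - G) \<union> (C - (U\<^sub>1 \<union> A\<^sub>2))) = card (F - G) + card (C - (U\<^sub>1 \<union> A\<^sub>2))"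
      using FD(2,3) finC C by (intro card_Un_disjoint) auto
    ultimately have eq: "rank N\<^sub>1 F + rank M C =
        rank N\<^sub>1 G + card U\<^sub>1 + card A\<^sub>2 + card (F - G) + card (C - (U\<^sub>1 \<union> A\<^sub>2))"
      using Z(2) 3(3) rank[OF FD(2)] by simp
    have le: "rank N\<^sub>1 F \<le> rank N\<^sub>1 G + card (F - G)" using FD(3) by (rule N1.rank_le_diff)
    \<comment> \<open>By \<open>top\<close> and \<open>card1\<close> the rank of \<open>C\<close> is
      at most \<open>card U\<^sub>1 + card A\<^sub>2\<close>, while \<open>eq\<close> and
      \<open>le\<close> make it at least that plus the number of points outside. Hence there are
      none, and the rank then forces equality.\<close>
    have "card (C - (U\<^sub>1 \<union> A\<^sub>2)) = 0" using eq le top card1 by linarith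
    then have sub: "C \<subseteq> U\<^sub>1 \<union> A\<^sub>2" using finC by simp
    have "card (U\<^sub>1 \<union> A\<^sub>2) \<le> card U\<^sub>1 + card A\<^sub>2" by (rule card_Un_le)
    also have "\<dots> \<le> rank M C" using eq le by linarith
    also have "\<dots> \<le> card C" using finC by (rule M.rank_le_card)
    finally show ?thesis using finU1 finite_A by (intro card_seteq[OF _ sub]) auto
  qed
qed

text \<open>If \<open>C'\<close> is contracted further to reach \<open>N\<^sub>1\<close>, then
  \<open>C' \<union> C\<close> is the unique possible set
  \<open>U\<^sub>1 \<union> A\<^sub>2\<close>, and both \<open>C'\<close> and \<open>C\<close> avoid
  \<open>D\<close>.\<close>

lemma contracted_through_minor:
  assumes "C \<subseteq> ground M" "C \<inter> ground N\<^sub>1 = {}" "C \<inter> D = {}"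
    and N: "minor_of N\<^sub>1 (delete (contract M C) D)"
    and ne: "proper_cyclic_flats N\<^sub>1 \<noteq> {A\<^sub>1}"
  shows "C \<subseteq> U\<^sub>1 \<union> A\<^sub>2" "U\<^sub>1 \<inter> D = {}"
proof -
  obtain F where F: "F \<in> proper_cyclic_flats N\<^sub>1" "F \<noteq> A\<^sub>1"
    using ne N1.uniformI nonuniform1 by blast
  obtain C' where C': "C' \<subseteq> ground M - C - D - ground N\<^sub>1"
    "\<And>X. X \<subseteq> ground N\<^sub>1 \<Longrightarrow> rank N\<^sub>1 X + rank M (C' \<union> C) = rank M (X \<union> (C' \<union> C))"
    using M.minor_of_minorE[OF assms(1) N] by metis
  have eq: "C' \<union> C = U\<^sub>1 \<union> A\<^sub>2"
    using assms(1,2) C'(1) ground_M by (intro contracted_set_unique[OF F _ C'(2)]) auto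
  show "C \<subseteq> U\<^sub>1 \<union> A\<^sub>2" using eq by blast
  show "U\<^sub>1 \<inter> D = {}" using eq C'(1) assms(3) by blast
qed

end

section \<open>Minimality of the amalgam among minors having both matroids as minors\<close>

theorem theorem3p6:
  fixes M\<^sub>1 M\<^sub>2 :: "'a indep_system"
    and S\<^sub>1' S\<^sub>2' T\<^sub>1 T\<^sub>2 :: "'a set"
    and k :: nat
  assumes "matroid M\<^sub>1" and "matroid M\<^sub>2"
    and "rank M\<^sub>1 (ground M\<^sub>1) > 0" and "rank M\<^sub>2 (ground M\<^sub>2) > 0"
    and "ground M\<^sub>1 \<inter> ground M\<^sub>2 = {}"
    and "S\<^sub>1' \<subseteq> ground M\<^sub>1" and "S\<^sub>2' \<subseteq> ground M\<^sub>2"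
    and "k \<ge> rank M\<^sub>1 (ground M\<^sub>1) + nullity M\<^sub>1 S\<^sub>1' + rank M\<^sub>2 (ground M\<^sub>2) + nullity M\<^sub>2 S\<^sub>2'"
    and "finite T\<^sub>1" and "finite T\<^sub>2"
    and "int (card T\<^sub>1) = int k - int (rank M\<^sub>1 (ground M\<^sub>1)) - int (card S\<^sub>2')"
    and "int (card T\<^sub>2) = int k - int (rank M\<^sub>2 (ground M\<^sub>2)) - int (card S\<^sub>1')"
    and "T\<^sub>1 \<inter> T\<^sub>2 = {}"
    and "T\<^sub>1 \<inter> (ground M\<^sub>1 \<union> ground M\<^sub>2) = {}" and "T\<^sub>2 \<inter> (ground M\<^sub>1 \<union> ground M\<^sub>2) = {}"
    and "\<not> uniform M\<^sub>1" and "\<not> uniform M\<^sub>2"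
    and "proper_cyclic_flats M\<^sub>1 \<noteq> {S\<^sub>1'}" and "proper_cyclic_flats M\<^sub>2 \<noteq> {S\<^sub>2'}"
  shows "labelled_intertwine (M_k k M\<^sub>1 S\<^sub>1' T\<^sub>1 M\<^sub>2 S\<^sub>2' T\<^sub>2) M\<^sub>1 M\<^sub>2"
proof -
  interpret amalgam M\<^sub>1 S\<^sub>1' T\<^sub>1 M\<^sub>2 S\<^sub>2' T\<^sub>2 k
    using assms by (intro amalgam.intro) (assumption | linarith)+
  have minor2: "minor_of M\<^sub>2 M"
    using amalgam.minor_N1[OF swap] unfolding swap_M .
  have "N = M" if N: "minor_of N M" and N1: "minor_of M\<^sub>1 N" and N2: "minor_of M\<^sub>2 N" for N
  proof -
    obtain C D where CD: "C \<subseteq> ground M" "D \<subseteq> ground M" "C \<inter> D = {}"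
      and N_eq: "N = delete (contract M C) D"
      using N unfolding minor_of_def by blast
    have ground: "ground M\<^sub>1 \<subseteq> ground M - C - D" "ground M\<^sub>2 \<subseteq> ground M - C - D"
      using M.minor_of_minorE[OF CD(1)] N1 N2 unfolding N_eq by metis+
    then have disj: "C \<inter> ground M\<^sub>1 = {}" "C \<inter> ground M\<^sub>2 = {}" by auto
    have 1: "C \<subseteq> T\<^sub>1 \<union> S\<^sub>2'" "T\<^sub>1 \<inter> D = {}"
      using contracted_through_minor[OF CD(1) disj(1) CD(3)] N1 assms(18) unfolding N_eq by auto
    have 2: "C \<subseteq> T\<^sub>2 \<union> S\<^sub>1'" "T\<^sub>2 \<inter> D = {}"
      using amalgam.contracted_through_minor[OF swap, unfolded swap_M, OF CD(1) disj(2) CD(3)]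
        N2 assms(19) unfolding N_eq by auto
    \<comment> \<open>The sets allowed for \<open>C\<close> by the two sides are disjoint. Likewise
      \<open>D\<close> misses both ground sets and both \<open>T\<^sub>1\<close> and
      \<open>T\<^sub>2\<close>, which together make up \<open>E\<close>.\<close>
    have "C = {}" using 1(1) 2(1) U U1 U2 A1 A2 disjoint by blast
    moreover have "D = {}" using CD(2) 1(2) 2(2) ground ground_M unfolding E_def by blast
    ultimately show ?thesis using N_eq M.delete_contract_empty by simp
  qed
  then show ?thesis
    using M.matroid_axioms minor_N1 minor2 unfolding labelled_intertwine_def M_def by blast
qed

end
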